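(* Let $n\ge1$, $1\le p<\infty$, $0\leq\gamma<1$, $1<q,s<\infty$, and let $w,v$ be nonnegative measurable functions on $\mathbb{R}^{n+1}$. Assume that $$[(w,v)]_{A^+_{q,q,s}(\gamma)} = \sup_{R \subset \mathbb{R}^{n+1}} \biggl( \frac{1}{|R^-(\gamma)|}\int_{R^-(\gamma)} w \,dx\,dt \biggr) \biggl( \frac{1}{|R^+(\gamma)|}\int_{R^+(\gamma)} v^{\frac{s}{1-q}} \,dx\,dt \biggr)^{\frac{q-1}{s}} < \infty,$$ where the supremum is over all parabolic rectangles $R\subset\mathbb{R}^{n+1}$. Then there is a constant $C=C(n,p,\gamma,q,s)$ such that $$\int_{\mathbb{R}^{n+1}} (M_c^{\gamma+}f)^q \, w \,dx\,dt \leq C\, [(w,v)]_{A_{q,q,s}^+(\gamma)} \int_{\mathbb{R}^{n+1}} |f|^q \, v \,dx\,dt$$ for every $f\in L^1_{\mathrm{loc}}(\mathbb{R}^{n+1})$.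
   Context: Write points of $\mathbb{R}^{n+1}$ as $(x,t)$ with $x\in\mathbb{R}^n$, $t\in\mathbb{R}$; $|A|$ is the Lebesgue measure of $A\subset\mathbb{R}^{n+1}$. The parameter $1\le p<\infty$ is fixed. For $x\in\mathbb{R}^n$ and $L>0$, let $Q(x,L)=\{y\in\mathbb{R}^n: |y_i-x_i|\le L/2,\ i=1,\dots,n\}$. A parabolic rectangle centered at $(x,t)$ with sidelength $L>0$ is $R=R(x,t,L,p)=Q(x,L)\times(t-L^p,t+L^p)$. For $0\le\gamma<1$ (the time lag), its upper and lower parts are $$R^+(\gamma)=Q(x,L)\times(t+\gamma L^p,t+L^p),\qquad R^-(\gamma)=Q(x,L)\times(t-L^p,t-\gamma L^p),$$ and $z(R^{\pm}(\gamma))$ denotes the center point of $R^{\pm}(\gamma)$. The convention $0\cdot\infty=0$ is used in the products above. For $f\in L^1_{\mathrm{loc}}(\mathbb{R}^{n+1})$, the centered forward in time parabolic maximal function is $$M^{\gamma+}_{c} f(x,t)=\sup_{z(R^-(\gamma))=(x,t)} \frac{1}{|R^+(\gamma)|}\int_{R^+(\gamma)}|f|,$$ the supremum being over all parabolic rectangles $R\subset\mathbb{R}^{n+1}$ such that $(x,t)$ is the center point of $R^-(\gamma)$. *)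

theory Defs
  imports "HOL-Analysis.Analysis"
begin

text \<open>Points of the space-time \<open>\<real>\<^sup>n\<^sup>+\<^sup>1\<close> are pairs \<open>(x, t) :: (real ^ 'n) \<times> real\<close> with
  \<open>n = CARD('n)\<close>. A parabolic rectangle is given by its centre \<open>(x, t)\<close> and its sidelength
  \<open>L > 0\<close>; a supremum over all parabolic rectangles is a supremum over these parameters.\<close>

definition space_cube :: "real ^ 'n \<Rightarrow> real \<Rightarrow> (real ^ 'n) set"
  where "space_cube x L = {y. \<forall>i. \<bar>y $ i - x $ i\<bar> \<le> L / 2}"

definition upper_part :: "real \<Rightarrow> real \<Rightarrow> real ^ 'n \<Rightarrow> real \<Rightarrow> real \<Rightarrow> ((real ^ 'n) \<times> real) set"
  where "upper_part p \<gamma> x t L = space_cube x L \<times> {t + \<gamma> * L powr p <..< t + L powr p}"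

definition lower_part :: "real \<Rightarrow> real \<Rightarrow> real ^ 'n \<Rightarrow> real \<Rightarrow> real \<Rightarrow> ((real ^ 'n) \<times> real) set"
  where "lower_part p \<gamma> x t L = space_cube x L \<times> {t - L powr p <..< t - \<gamma> * L powr p}"

definition lower_center :: "real \<Rightarrow> real \<Rightarrow> real ^ 'n \<Rightarrow> real \<Rightarrow> real \<Rightarrow> (real ^ 'n) \<times> real"
  where "lower_center p \<gamma> x t L = (x, midpoint (t - L powr p) (t - \<gamma> * L powr p))"

text \<open>Unlike \<open>powr\<close> on the reals, where \<open>0 powr a = 0\<close> for every \<open>a\<close>, a negative power of
  \<open>0\<close> is \<open>\<infinity>\<close> here. This matters for \<open>v powr (s / (1 - q))\<close> on the zero set of \<open>v\<close>.\<close>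

definition ennreal_powr :: "ennreal \<Rightarrow> real \<Rightarrow> ennreal"
  where "ennreal_powr x a =
    (if a = 0 then 1
     else if x = 0 then (if a > 0 then 0 else \<infinity>)
     else if x = \<infinity> then (if a > 0 then \<infinity> else 0)
     else ennreal (enn2real x powr a))"

definition average :: "'a::euclidean_space set \<Rightarrow> ('a \<Rightarrow> ennreal) \<Rightarrow> ennreal"
  where "average A g = (\<integral>\<^sup>+z\<in>A. g z \<partial>lebesgue) / emeasure lebesgue A"

text \<open>The product below uses \<open>0 * \<infinity> = 0\<close>, which holds in \<open>ennreal\<close>.\<close>

definition bump_constant ::
  "real \<Rightarrow> real \<Rightarrow> real \<Rightarrow> real \<Rightarrow> ((real ^ 'n) \<times> real \<Rightarrow> real) \<Rightarrow> ((real ^ 'n) \<times> real \<Rightarrow> real) \<Rightarrow> ennreal"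
  where "bump_constant p \<gamma> q s w v =
    (SUP (x, t, L) \<in> {(x, t, L). 0 < L}.
       average (lower_part p \<gamma> x t L) (\<lambda>z. ennreal (w z)) *
       ennreal_powr
         (average (upper_part p \<gamma> x t L) (\<lambda>z. ennreal_powr (ennreal (v z)) (s / (1 - q))))
         ((q - 1) / s))"

definition locally_integrable :: "('a::euclidean_space \<Rightarrow> real) \<Rightarrow> bool"
  where "locally_integrable f \<longleftrightarrow> (\<forall>K. compact K \<longrightarrow> f absolutely_integrable_on K)"

definition centered_forward_maximal ::
  "real \<Rightarrow> real \<Rightarrow> ((real ^ 'n) \<times> real \<Rightarrow> real) \<Rightarrow> (real ^ 'n) \<times> real \<Rightarrow> ennreal"
  where "centered_forward_maximal p \<gamma> f z =
    (SUP (x, t, L) \<in> {(x, t, L). 0 < L \<and> lower_center p \<gamma> x t L = z}.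
       average (upper_part p \<gamma> x t L) (\<lambda>y. ennreal \<bar>f y\<bar>))"

end

theory Submission
  imports Defs
begin

text \<open>Since \<open>s > 1\<close>, there are \<open>1 < a < r < q\<close> for which Hoelder's inequality turns the bump condition
  into a bound of \<open>(avg |f|)^r * (avg w)\<close>, with \<open>|f|\<close> averaged over the upper and \<open>w\<close> over the lower part,
  by \<open>[(w,v)] * (avg g^a)^(r/a)\<close>, with \<open>g = |f| * v^(1/r)\<close> averaged over the upper part. Because the points of
  a level set of the maximal function are centres of lower parts, each of them lies in a dyadic
  parabolic cell that is contained in, and comparable to, such a lower part. The maximal cells are
  disjoint and cover the level set exactly, so no doubling of \<open>w\<close> is needed, and the lag between
  the two parts only matters for Lebesgue measure: a cell and its upper part lie in a common parabolic
  ball of comparable size, and the sum of \<open>|K| (avg g^a)^(r/a)\<close> over the cells \<open>K\<close> is controlled as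
  in the Hardy--Littlewood theorem, using \<open>r/a > 1\<close>. This is a weak type \<open>(r,r)\<close> bound, applied
  to the part of \<open>f\<close> above half the level, so interpolation gives strong type \<open>(q,q)\<close>.\<close>

section \<open>Powers and Hoelder's inequality\<close>

lemma ennreal_powr_ennreal:
  "0 \<le> x \<Longrightarrow> 0 < a \<Longrightarrow> ennreal_powr (ennreal x) a = ennreal (x powr a)"
  by (auto simp: ennreal_powr_def ennreal_eq_0_iff)

lemma ennreal_powr_top: "0 < a \<Longrightarrow> ennreal_powr \<infinity> a = \<infinity>"
  by (simp add: ennreal_powr_def)

lemma ennreal_powr_0: "0 < a \<Longrightarrow> ennreal_powr 0 a = 0"
  by (simp add: ennreal_powr_def)

lemma ennreal_powr_0_neg: "a < 0 \<Longrightarrow> ennreal_powr 0 a = \<infinity>"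
  by (simp add: ennreal_powr_def)

lemma ennreal_powr_pos_ennreal:
  "0 < x \<Longrightarrow> ennreal_powr (ennreal x) a = ennreal (x powr a)"
  by (auto simp: ennreal_powr_def)

lemma ennreal_powr_mono:
  assumes "0 < a" "x \<le> y"
  shows "ennreal_powr x a \<le> ennreal_powr y a"
proof (cases y rule: ennreal_cases)
  case (real b)
  with assms obtain c where "x = ennreal c" "0 \<le> c" "c \<le> b"
    by (cases x rule: ennreal_cases) (auto simp: top_unique)
  with real assms show ?thesis
    by (simp add: ennreal_powr_ennreal powr_mono2)
qed (use assms in \<open>simp add: ennreal_powr_top[simplified]\<close>)

lemma ennreal_powr_mult:
  assumes "0 < a"
  shows "ennreal_powr (x * y) a = ennreal_powr x a * ennreal_powr y a"
  using assms
  by (cases x rule: ennreal_cases; cases y rule: ennreal_cases)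
     (auto simp: ennreal_powr_ennreal ennreal_mult[symmetric] powr_mult ennreal_powr_def
       ennreal_mult_eq_top_iff ennreal_top_mult ennreal_mult_top)

lemma ennreal_powr_powr:
  assumes "0 < a" "0 < b"
  shows "ennreal_powr (ennreal_powr x a) b = ennreal_powr x (a * b)"
  using assms
  by (cases x rule: ennreal_cases)
     (auto simp: ennreal_powr_ennreal powr_powr ennreal_powr_top[simplified])

lemma ennreal_powr_eq_0_iff: "0 < a \<Longrightarrow> ennreal_powr x a = 0 \<longleftrightarrow> x = 0"
  by (cases x rule: ennreal_cases)
     (auto simp: ennreal_powr_ennreal ennreal_powr_top[simplified])

lemma ennreal_powr_measurable [measurable]:
  assumes [measurable]: "g \<in> borel_measurable M"
  shows "(\<lambda>x. ennreal_powr (g x) a) \<in> borel_measurable M"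
  unfolding ennreal_powr_def by measurable

section \<open>Young's and Hoelder's inequalities\<close>

text \<open>Convexity of \<open>exp\<close> at \<open>a * ln x\<close> and \<open>b * ln y\<close>
  with weights \<open>1 / a\<close> and \<open>1 / b\<close>; the logarithms are why a zero factor
  is split off first.\<close>

lemma Young_inequality:
  fixes x y a b :: real
  assumes "0 \<le> x" "0 \<le> y" "1 < a" "1 < b" "1 / a + 1 / b = 1"
  shows "x * y \<le> x powr a / a + y powr b / b"
proof (cases "x = 0 \<or> y = 0")
  case True
  with assms show ?thesis by auto
next
  case False
  then have "0 < x" "0 < y" using assms by auto
  have "exp ((1 - 1 / a) *\<^sub>R (b * ln y) + (1 / a) *\<^sub>R (a * ln x))
      \<le> (1 - 1 / a) * exp (b * ln y) + (1 / a) * exp (a * ln x)"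
    using assms by (intro convex_onD[OF exp_convex]) auto
  moreover have "1 - 1 / a = 1 / b" using assms by simp
  ultimately have "exp (ln y + ln x) \<le> exp (b * ln y) / b + exp (a * ln x) / a"
    using assms by simp
  then show ?thesis
    using \<open>0 < x\<close> \<open>0 < y\<close> by (simp add: powr_def exp_add mult.commute add.commute)
qed

lemma Holder_nn_integral:
  fixes u w :: "'a \<Rightarrow> real"
  assumes [measurable]: "u \<in> borel_measurable M" "w \<in> borel_measurable M"
    and nn: "\<And>x. 0 \<le> u x" "\<And>x. 0 \<le> w x"
    and ab: "1 < a" "1 < b" "1 / a + 1 / b = 1"
  shows "(\<integral>\<^sup>+x. ennreal (u x * w x) \<partial>M) \<le>
    ennreal_powr (\<integral>\<^sup>+x. ennreal (u x powr a) \<partial>M) (1 / a) *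
    ennreal_powr (\<integral>\<^sup>+x. ennreal (w x powr b) \<partial>M) (1 / b)"
proof -
  define X where "X = (\<integral>\<^sup>+x. ennreal (u x powr a) \<partial>M)"
  define Y where "Y = (\<integral>\<^sup>+x. ennreal (w x powr b) \<partial>M)"
  \<comment> \<open>The cases \<open>X = 0\<close> and \<open>Y = 0\<close> come before the infinite
    ones: by \<open>0 * \<infinity> = 0\<close> the right-hand side vanishes there, so the integrand
    has to be null almost everywhere.\<close>
  consider "X = 0" | "Y = 0" | "X \<noteq> 0" "Y \<noteq> 0" "X = \<infinity> \<or> Y = \<infinity>"
    | "X \<noteq> 0" "Y \<noteq> 0" "X \<noteq> \<infinity>" "Y \<noteq> \<infinity>" by blast
  then have "(\<integral>\<^sup>+x. ennreal (u x * w x) \<partial>M) \<le> ennreal_powr X (1 / a) * ennreal_powr Y (1 / b)"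
  proof cases
    case 1
    then have "AE x in M. u x powr a = 0"
      unfolding X_def by (subst (asm) nn_integral_0_iff_AE) (auto simp: ennreal_eq_0_iff order.antisym)
    then have "AE x in M. ennreal (u x * w x) = 0" by (auto elim!: eventually_mono)
    then have "(\<integral>\<^sup>+x. ennreal (u x * w x) \<partial>M) = (\<integral>\<^sup>+x. 0 \<partial>M)"
      by (rule nn_integral_cong_AE)
    then show ?thesis by simp
  next
    case 2
    then have "AE x in M. w x powr b = 0"
      unfolding Y_def by (subst (asm) nn_integral_0_iff_AE) (auto simp: ennreal_eq_0_iff order.antisym)
    then have "AE x in M. ennreal (u x * w x) = 0" by (auto elim!: eventually_mono)
    then have "(\<integral>\<^sup>+x. ennreal (u x * w x) \<partial>M) = (\<integral>\<^sup>+x. 0 \<partial>M)"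
      by (rule nn_integral_cong_AE)
    then show ?thesis by simp
  next
    case 3
    then have "ennreal_powr X (1 / a) * ennreal_powr Y (1 / b) = \<infinity>"
      using ab by (auto simp: ennreal_mult_eq_top_iff ennreal_powr_eq_0_iff ennreal_powr_top[simplified])
    then show ?thesis by simp
  next
    case 4
    then obtain x y where x: "X = ennreal x" "0 < x" and y: "Y = ennreal y" "0 < y"
      by (cases X rule: ennreal_cases; cases Y rule: ennreal_cases) (auto simp: less_le)
    \<comment> \<open>\<open>c\<close> is the right-hand side. Young's inequality is applied to
      \<open>u\<close> and \<open>w\<close> divided by their norms; integrating it gives
      \<open>c\<close> times \<open>1 / a + 1 / b = 1\<close>.\<close>
    define c where "c = x powr (1 / a) * y powr (1 / b)"
    have "c > 0" using x y by (simp add: c_def)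
    have pt: "u z * w z \<le> c / (a * x) * u z powr a + c / (b * y) * w z powr b" for z
    proof -
      have "(u z / x powr (1 / a)) * (w z / y powr (1 / b))
          \<le> (u z / x powr (1 / a)) powr a / a + (w z / y powr (1 / b)) powr b / b"
        by (rule Young_inequality) (use nn ab x y in auto)
      also have "\<dots> = u z powr a / (a * x) + w z powr b / (b * y)"
        using nn ab x y by (simp add: powr_divide powr_powr mult.commute)
      finally have "u z * w z / c \<le> u z powr a / (a * x) + w z powr b / (b * y)"
        by (simp add: c_def)
      then show ?thesis using \<open>c > 0\<close> by (simp add: field_simps)
    qed
    have "(\<integral>\<^sup>+z. ennreal (u z * w z) \<partial>M) \<le>
      (\<integral>\<^sup>+z. ennreal (c / (a * x)) * ennreal (u z powr a) + ennreal (c / (b * y)) * ennreal (w z powr b) \<partial>M)"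
      using pt ab x y \<open>c > 0\<close>
      by (intro nn_integral_mono) (simp add: ennreal_mult[symmetric] ennreal_plus[symmetric] ennreal_leI del: ennreal_plus)
    also have "\<dots> = ennreal (c / (a * x)) * X + ennreal (c / (b * y)) * Y"
      by (simp add: nn_integral_add nn_integral_cmult X_def Y_def)
    also have "\<dots> = ennreal (c / (a * x) * x + c / (b * y) * y)"
      using ab x(2) y(2) \<open>c > 0\<close> unfolding x(1) y(1)
      by (subst (1 2) ennreal_mult[symmetric]) (auto simp: ennreal_plus[symmetric] simp del: ennreal_plus)
    also have "c / (a * x) * x + c / (b * y) * y = c * (1 / a + 1 / b)"
      using x y by (simp add: field_simps)
    finally show ?thesis
      using ab x y by (simp add: c_def ennreal_powr_ennreal ennreal_mult)
  qed
  then show ?thesis by (simp add: X_def Y_def)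
qed

text \<open>The exponent \<open>b\<close> is the one with \<open>(v powr (- 1 / r)) powr b = v powr (s / (1 - q))\<close>.\<close>

lemma Holder_two_weight:
  fixes f v :: "'a \<Rightarrow> real"
  assumes [measurable]: "f \<in> borel_measurable M" "v \<in> borel_measurable M"
    and nn: "\<And>x. 0 \<le> f x" "\<And>x. 0 \<le> v x"
    and "1 < q" "1 < s" "0 < r" and ab: "1 < a" "b = r * s / (q - 1)" "1 < b" "1 / a + 1 / b = 1"
    and le: "W * ennreal_powr (\<integral>\<^sup>+x. ennreal_powr (ennreal (v x)) (s / (1 - q)) \<partial>M) ((q - 1) / s) \<le> B"
    and "B < \<infinity>"
  shows "ennreal_powr (\<integral>\<^sup>+x. ennreal (f x) \<partial>M) r * W \<le>
    ennreal_powr (\<integral>\<^sup>+x. ennreal ((f x * v x powr (1 / r)) powr a) \<partial>M) (r / a) * B"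
proof -
  let ?S = "\<integral>\<^sup>+x. ennreal_powr (ennreal (v x)) (s / (1 - q)) \<partial>M"
  have exps: "0 < (q - 1) / s" "s / (1 - q) < 0" using assms by (auto simp: divide_simps)
  show ?thesis
  \<comment> \<open>An infinite dual integral forces \<open>W = 0\<close>, since
    \<open>W * \<infinity>\<close> is at most \<open>B < \<infinity>\<close>.\<close>
  proof (cases "?S = \<infinity>")
    case True
    then have "W * \<infinity> < \<infinity>"
      using le \<open>B < \<infinity>\<close> exps by (simp add: ennreal_powr_top[simplified] order_le_less_trans)
    then have "W = 0" by (auto simp: ennreal_mult_top split: if_splits)
    then show ?thesis by simp
  next
    case False
    \<comment> \<open>\<open>ennreal_powr 0\<close> is infinite at a negative exponent, so a finite
      \<open>?S\<close> makes \<open>v\<close> positive almost everywhere. This allows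
      \<open>f\<close> to be split as \<open>f * v powr (1 / r)\<close> times
      \<open>v powr (- 1 / r)\<close>.\<close>
    have "AE x in M. ennreal_powr (ennreal (v x)) (s / (1 - q)) \<noteq> \<infinity>"
      using False by (intro nn_integral_PInf_AE) auto
    then have pos: "AE x in M. 0 < v x"
    proof eventually_elim
      case (elim x)
      then have "v x \<noteq> 0" using ennreal_powr_0_neg[OF exps(2)] by auto
      then show ?case using nn(2)[of x] by simp
    qed
    have "(\<integral>\<^sup>+x. ennreal (f x) \<partial>M)
        = (\<integral>\<^sup>+x. ennreal ((f x * v x powr (1 / r)) * v x powr (- 1 / r)) \<partial>M)"
      by (rule nn_integral_cong_AE, use pos in eventually_elim)
         (simp add: powr_add[symmetric] mult.assoc)
    also have "\<dots> \<le> ennreal_powr (\<integral>\<^sup>+x. ennreal ((f x * v x powr (1 / r)) powr a) \<partial>M) (1 / a) *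
        ennreal_powr (\<integral>\<^sup>+x. ennreal ((v x powr (- 1 / r)) powr b) \<partial>M) (1 / b)"
      using ab nn by (intro Holder_nn_integral) auto
    also have "(\<integral>\<^sup>+x. ennreal ((v x powr (- 1 / r)) powr b) \<partial>M) = ?S"
    proof (rule nn_integral_cong_AE, use pos in eventually_elim)
      case (elim x)
      have "- 1 / r * b = s / (1 - q)" using assms by (simp add: divide_simps) (simp add: algebra_simps)
      then show ?case using elim by (simp add: powr_powr ennreal_powr_pos_ennreal)
    qed
    finally have "ennreal_powr (\<integral>\<^sup>+x. ennreal (f x) \<partial>M) r \<le>
        ennreal_powr (ennreal_powr (\<integral>\<^sup>+x. ennreal ((f x * v x powr (1 / r)) powr a) \<partial>M) (1 / a) *
          ennreal_powr ?S (1 / b)) r"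
      using \<open>0 < r\<close> by (intro ennreal_powr_mono)
    also have "\<dots> = ennreal_powr (\<integral>\<^sup>+x. ennreal ((f x * v x powr (1 / r)) powr a) \<partial>M) (r / a) *
        ennreal_powr ?S ((q - 1) / s)"
    proof -
      \<comment> \<open>Raising to the power \<open>r\<close> turns the dual exponent
        \<open>1 / b\<close> into the power \<open>(q - 1) / s\<close> of the bump
        condition.\<close>
      have "1 / b * r = (q - 1) / s" using assms by (simp add: divide_simps mult.commute)
      moreover have "0 < 1 / a" "0 < 1 / b" using ab(1,3) by simp_all
      ultimately show ?thesis
        using \<open>0 < r\<close> by (simp only: ennreal_powr_mult ennreal_powr_powr times_divide_eq_left mult_1_left)
    qed
    finally have "ennreal_powr (\<integral>\<^sup>+x. ennreal (f x) \<partial>M) r * W \<le>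
       ennreal_powr (\<integral>\<^sup>+x. ennreal ((f x * v x powr (1 / r)) powr a) \<partial>M) (r / a) *
        ennreal_powr ?S ((q - 1) / s) * W"
      by (rule mult_right_mono) simp
    also have "\<dots> = ennreal_powr (\<integral>\<^sup>+x. ennreal ((f x * v x powr (1 / r)) powr a) \<partial>M) (r / a) *
        (W * ennreal_powr ?S ((q - 1) / s))"
      by (simp add: mult_ac)
    also have "\<dots> \<le> ennreal_powr (\<integral>\<^sup>+x. ennreal ((f x * v x powr (1 / r)) powr a) \<partial>M) (r / a) * B"
      by (intro mult_left_mono le) simp
    finally show ?thesis .
  qed
qed

section \<open>Interpolation\<close>

text \<open>Sums over all integers are written as integrals over \<open>count_space\<close>, so that
  Tonelli's theorem applies to them. Substituting \<open>k = m - n\<close> leaves a geometric series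
  in \<open>n\<close>.\<close>

lemma nn_integral_geometric_int:
  assumes "0 < d"
  shows "(\<integral>\<^sup>+k. ennreal (2 powr (real_of_int k * d)) * indicator {..m} k \<partial>count_space UNIV)
    = ennreal (2 powr (real_of_int m * d) / (1 - 2 powr (- d)))"
proof -
  have bij: "bij_betw (\<lambda>n. m - int n) UNIV {..m}"
    by (rule bij_betw_byWitness[where f' = "\<lambda>k. nat (m - k)"]) auto
  have "(\<integral>\<^sup>+k. ennreal (2 powr (real_of_int k * d)) * indicator {..m} k \<partial>count_space UNIV)
      = (\<integral>\<^sup>+k. ennreal (2 powr (real_of_int k * d)) \<partial>count_space {..m})"
    by (simp add: nn_integral_count_space_indicator)
  also have "\<dots> = (\<integral>\<^sup>+n. ennreal (2 powr (real_of_int (m - int n) * d)) \<partial>count_space UNIV)"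
    by (rule nn_integral_bij_count_space[OF bij, symmetric])
  also have "\<dots> = (\<Sum>n. ennreal (2 powr (real_of_int m * d) * (2 powr (- d)) ^ n))"
    by (simp add: nn_integral_count_space_nat powr_realpow[symmetric] powr_powr powr_add[symmetric] algebra_simps)
  also have "\<dots> = ennreal (2 powr (real_of_int m * d) * (1 / (1 - 2 powr (- d))))"
  proof (rule suminf_ennreal_eq)
    show "(\<lambda>n. 2 powr (real_of_int m * d) * (2 powr (- d)) ^ n) sums
        (2 powr (real_of_int m * d) * (1 / (1 - 2 powr (- d))))"
      using assms by (intro sums_mult geometric_sums) (simp add: powr_less_one)
  qed simp
  finally show ?thesis by simp
qed

lemma obtain_dyadic_above:
  fixes y :: real
  assumes "0 < y"
  obtains k :: int where "2 powr (real_of_int k) < y" "y \<le> 2 powr (real_of_int (k + 1))"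
proof -
  \<comment> \<open>Ceiling minus one instead of the floor: the lower inequality has to be strict,
    to match strict level sets.\<close>
  define k where "k = \<lceil>log 2 y\<rceil> - 1"
  have "real_of_int k < log 2 y" "log 2 y \<le> real_of_int (k + 1)"
    unfolding k_def by linarith+
  then show ?thesis
    using that[of k] assms by (simp add: less_log_iff log_le_iff)
qed

text \<open>For finite positive \<open>x\<close> the single term with
  \<open>2 powr k < x \<le> 2 powr (k + 1)\<close> suffices, at the cost of \<open>2 powr q\<close>.
  For \<open>x = \<infinity>\<close> every integer contributes and the sum diverges.\<close>

lemma ennreal_powr_le_dyadic_sum:
  assumes "0 < q"
  shows "ennreal_powr x q \<le> ennreal (2 powr q) *
    (\<integral>\<^sup>+k. ennreal (2 powr (real_of_int k * q)) * indicator {k. ennreal (2 powr real_of_int k) < x} k \<partial>count_space UNIV)"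
    (is "_ \<le> _ * ?S")
proof (cases x rule: ennreal_cases)
  case (real y)
  show ?thesis
  proof (cases "y = 0")
    case True
    then show ?thesis using real assms by (simp add: ennreal_powr_0)
  next
    case False
    then obtain k :: int where k: "2 powr (real_of_int k) < y" "y \<le> 2 powr (real_of_int (k + 1))"
      using obtain_dyadic_above[of y] real by force
    have "ennreal_powr x q = ennreal (y powr q)" using real assms by (simp add: ennreal_powr_ennreal)
    also have "\<dots> \<le> ennreal ((2 powr (real_of_int (k + 1))) powr q)"
      using k real assms by (intro ennreal_leI powr_mono2) auto
    also have "\<dots> = ennreal (2 powr q) * ennreal (2 powr (real_of_int k * q))"
      by (simp add: powr_powr ennreal_mult[symmetric] powr_add[symmetric] algebra_simps)
    also have "ennreal (2 powr (real_of_int k * q)) \<le> ?S"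
    proof -
      have "ennreal (2 powr (real_of_int k * q))
          = (\<integral>\<^sup>+j. ennreal (2 powr (real_of_int j * q)) * indicator {k} j \<partial>count_space UNIV)"
        by (simp add: nn_integral_count_space_indicator[symmetric] nn_integral_count_space_finite)
      also have "\<dots> \<le> ?S"
        using k real by (intro nn_integral_mono) (auto simp: indicator_def ennreal_less_iff)
      finally show ?thesis .
    qed
    finally show ?thesis by (simp add: mult_left_mono)
  qed
next
  case top
  have le: "ennreal (2 powr (real_of_int m * q)) \<le> ?S" for m
  proof -
    have "2 powr (- q) < (1 :: real)" using assms by (simp add: powr_less_one)
    then have "2 powr (real_of_int m * q) * (1 - 2 powr (- q)) \<le> 2 powr (real_of_int m * q) * 1"
      by (intro mult_left_mono) auto
    then have "2 powr (real_of_int m * q) \<le> 2 powr (real_of_int m * q) / (1 - 2 powr (- q))"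
      using \<open>2 powr (- q) < 1\<close> by (simp add: le_divide_eq)
    then have "ennreal (2 powr (real_of_int m * q)) \<le> ennreal (2 powr (real_of_int m * q) / (1 - 2 powr (- q)))"
      by (rule ennreal_leI)
    also have "\<dots> = (\<integral>\<^sup>+k. ennreal (2 powr (real_of_int k * q)) * indicator {..m} k \<partial>count_space UNIV)"
      by (rule nn_integral_geometric_int[OF assms, symmetric])
    also have "\<dots> \<le> ?S"
      by (intro nn_integral_mono) (auto simp: indicator_def top less_top[symmetric])
    finally show ?thesis .
  qed
  have "?S = \<infinity>"
  proof (rule ccontr)
    assume "?S \<noteq> \<infinity>"
    then obtain B where B: "?S = ennreal B" "0 \<le> B" by (cases ?S rule: ennreal_cases) auto
    define m where "m = \<lceil>log 2 (B + 1) / q\<rceil>"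
    have "log 2 (B + 1) \<le> real_of_int m * q"
      using assms unfolding m_def by (metis divide_le_eq le_of_int_ceiling)
    then have "B + 1 \<le> 2 powr (real_of_int m * q)" using B by (simp add: log_le_iff)
    then show False using le[of m] B by (simp add: ennreal_le_iff)
  qed
  then show ?thesis by (simp add: ennreal_mult_top)
qed

text \<open>\<open>F\<close> is not assumed measurable, so the integral bound is stated for a measurable majorant.\<close>

lemma Marcinkiewicz_dyadic:
  fixes F :: "'a \<Rightarrow> ennreal" and h :: "'b \<Rightarrow> real"
  assumes r: "0 < r" "r < q"
    and [measurable]: "h \<in> borel_measurable N" and h: "\<And>y. 0 \<le> h y"
    and weak: "\<And>k :: int. \<exists>U\<in>sets M. {x \<in> space M. ennreal (2 powr real_of_int k) < F x} \<subseteq> U \<and>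
        emeasure M U \<le> D * ennreal (2 powr (- real_of_int k * r)) *
          (\<integral>\<^sup>+y. ennreal (h y powr r) * indicator {y. 2 powr real_of_int (k - 1) < h y} y \<partial>N)"
  shows "\<exists>G\<in>borel_measurable M. (\<forall>x\<in>space M. ennreal_powr (F x) q \<le> G x) \<and>
    (\<integral>\<^sup>+x. G x \<partial>M) \<le> ennreal (2 powr (2 * q) / (1 - 2 powr (r - q))) * D * (\<integral>\<^sup>+y. ennreal (h y powr q) \<partial>N)"
proof -
  define d where "d = q - r"
  have d: "0 < d" using r by (simp add: d_def)
  define I where "I k = (\<integral>\<^sup>+y. ennreal (h y powr r) * indicator {y. 2 powr real_of_int (k - 1) < h y} y \<partial>N)" for k :: int
  have "\<forall>k. \<exists>U. U \<in> sets M \<and> {x \<in> space M. ennreal (2 powr real_of_int k) < F x} \<subseteq> U \<and>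
      emeasure M U \<le> D * ennreal (2 powr (- real_of_int k * r)) * I k"
    using weak unfolding I_def by blast
  from choice[OF this] obtain U where U_all: "\<forall>k. U k \<in> sets M \<and>
      {x \<in> space M. ennreal (2 powr real_of_int k) < F x} \<subseteq> U k \<and>
      emeasure M (U k) \<le> D * ennreal (2 powr (- real_of_int k * r)) * I k" ..
  have [measurable]: "U k \<in> sets M" for k using U_all by blast
  have sub: "{x \<in> space M. ennreal (2 powr real_of_int k) < F x} \<subseteq> U k" for k
    using U_all by blast
  have U: "emeasure M (U k) \<le> D * ennreal (2 powr (- real_of_int k * r)) *
      (\<integral>\<^sup>+y. ennreal (h y powr r) * indicator {y. 2 powr real_of_int (k - 1) < h y} y \<partial>N)" for k
    using U_all unfolding I_def by blast
  \<comment> \<open>For fixed \<open>y\<close> only the levels with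
    \<open>2 powr (k - 1) < h y\<close> count. They end at \<open>m + 1\<close>, one beyond the
    dyadic size of \<open>h y\<close> because the truncation is at half the level, and the geometric
    sum is dominated by its top term. This needs \<open>r < q\<close>.\<close>
  have pt: "(\<integral>\<^sup>+k. ennreal (2 powr (real_of_int k * d)) *
        (ennreal (h y powr r) * indicator {y. 2 powr real_of_int (k - 1) < h y} y) \<partial>count_space UNIV)
      \<le> ennreal (2 powr q / (1 - 2 powr (- d))) * ennreal (h y powr q)" for y
  proof (cases "h y = 0")
    case True
    then show ?thesis using r by simp
  next
    case False
    then have pos: "0 < h y" using h[of y] by simp
    then obtain m :: int where m: "2 powr (real_of_int m) < h y" "h y \<le> 2 powr (real_of_int (m + 1))"
      by (rule obtain_dyadic_above)
    have "k \<le> m + 1" if "2 powr real_of_int (k - 1) < h y" for k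
    proof -
      have "2 powr real_of_int (k - 1) < 2 powr real_of_int (m + 1)"
        using that m by linarith
      then show ?thesis by simp
    qed
    then have "(\<integral>\<^sup>+k. ennreal (2 powr (real_of_int k * d)) *
        (ennreal (h y powr r) * indicator {y. 2 powr real_of_int (k - 1) < h y} y) \<partial>count_space UNIV)
      \<le> (\<integral>\<^sup>+k. ennreal (h y powr r) * (ennreal (2 powr (real_of_int k * d)) * indicator {..m+1} k) \<partial>count_space UNIV)"
      by (intro nn_integral_mono) (auto simp: indicator_def mult.commute)
    also have "\<dots> = ennreal (h y powr r) * ennreal (2 powr (real_of_int (m + 1) * d) / (1 - 2 powr (- d)))"
      by (simp only: nn_integral_cmult nn_integral_geometric_int[OF d] borel_measurable_count_space)
    also have "\<dots> = ennreal (h y powr r * (2 powr (real_of_int (m + 1) * d) / (1 - 2 powr (- d))))"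
      using d powr_less_one[of 2 "-d"] by (subst ennreal_mult[symmetric]) auto
    also have "\<dots> \<le> ennreal (h y powr r * ((2 powr q * h y powr d) / (1 - 2 powr (- d))))"
    proof (intro ennreal_leI mult_left_mono divide_right_mono)
      have "2 powr (real_of_int (m + 1) * d) = 2 powr d * (2 powr real_of_int m) powr d"
        by (simp add: powr_powr powr_add[symmetric] algebra_simps)
      also have "\<dots> \<le> 2 powr q * h y powr d"
        using m d r by (intro mult_mono powr_mono powr_mono2) (auto simp: d_def)
      finally show "2 powr (real_of_int (m + 1) * d) \<le> 2 powr q * h y powr d" .
    qed (use d powr_less_one[of 2 "-d"] in auto)
    also have "h y powr r * ((2 powr q * h y powr d) / (1 - 2 powr (- d)))
        = 2 powr q / (1 - 2 powr (- d)) * h y powr q"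
      using pos by (simp add: d_def powr_diff)
    also have "ennreal \<dots> = ennreal (2 powr q / (1 - 2 powr (- d))) * ennreal (h y powr q)"
      using d powr_less_one[of 2 "-d"] by (intro ennreal_mult) auto
    finally show ?thesis .
  qed
  \<comment> \<open>The measurable majorant: the dyadic sum for \<open>F\<close> with each level set
    replaced by its measurable cover \<open>U k\<close>.\<close>
  define G where "G x = ennreal (2 powr q) *
    (\<integral>\<^sup>+k. ennreal (2 powr (real_of_int k * q)) * indicator (U k) x \<partial>count_space UNIV)" for x
  \<comment> \<open>Enumerating the integers by \<open>int_decode\<close> turns \<open>G\<close>
    into a countable series, from which measurability can be read off.\<close>
  have "G x = ennreal (2 powr q) *
      (\<Sum>n. ennreal (2 powr (real_of_int (int_decode n) * q)) * indicator (U (int_decode n)) x)" for x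
    unfolding G_def nn_integral_count_space_nat[symmetric]
    by (subst nn_integral_bij_count_space[OF bij_int_decode, symmetric]) simp
  then have G_measurable: "G \<in> borel_measurable M"
    by (subst measurable_cong) auto
  have le_G: "ennreal_powr (F x) q \<le> G x" if "x \<in> space M" for x
    unfolding G_def using sub r that
    by (intro order_trans[OF ennreal_powr_le_dyadic_sum] mult_left_mono nn_integral_mono)
       (force simp: indicator_def)+
  have "(\<integral>\<^sup>+x. G x \<partial>M) = (\<integral>\<^sup>+x. ennreal (2 powr q) *
    (\<integral>\<^sup>+k. ennreal (2 powr (real_of_int k * q)) * indicator (U k) x \<partial>count_space UNIV) \<partial>M)"
    by (simp add: G_def)
  also have "\<dots> = (\<integral>\<^sup>+x. \<integral>\<^sup>+k. ennreal (2 powr q) *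
      (ennreal (2 powr (real_of_int k * q)) * indicator (U k) x) \<partial>count_space UNIV \<partial>M)"
    by (simp add: nn_integral_cmult)
  also have "\<dots> = (\<integral>\<^sup>+k. \<integral>\<^sup>+x. ennreal (2 powr q) *
      (ennreal (2 powr (real_of_int k * q)) * indicator (U k) x) \<partial>M \<partial>count_space UNIV)"
    by (rule nn_integral_count_space_nn_integral) auto
  also have "\<dots> = (\<integral>\<^sup>+k. ennreal (2 powr q) *
      (ennreal (2 powr (real_of_int k * q)) * emeasure M (U k)) \<partial>count_space UNIV)"
    by (simp add: nn_integral_cmult)
  also have "\<dots> = ennreal (2 powr q) * (\<integral>\<^sup>+k. ennreal (2 powr (real_of_int k * q)) * emeasure M (U k) \<partial>count_space UNIV)"
    by (simp add: nn_integral_cmult)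
  \<comment> \<open>The weak type bound enters here: \<open>2 powr (k * q)\<close> against
    \<open>2 powr (- k * r)\<close> leaves \<open>2 powr (k * d)\<close>. A second exchange of sum
    and integral then reduces everything to \<open>pt\<close>.\<close>
  also have "\<dots> \<le> ennreal (2 powr q) * (\<integral>\<^sup>+k. D * (\<integral>\<^sup>+y. ennreal (2 powr (real_of_int k * d)) *
        (ennreal (h y powr r) * indicator {y. 2 powr real_of_int (k - 1) < h y} y) \<partial>N) \<partial>count_space UNIV)"
  proof (intro mult_left_mono nn_integral_mono)
    fix k :: int
    have "ennreal (2 powr (real_of_int k * q)) * emeasure M (U k)
       \<le> ennreal (2 powr (real_of_int k * q)) * (D * ennreal (2 powr (- real_of_int k * r)) *
          (\<integral>\<^sup>+y. ennreal (h y powr r) * indicator {y. 2 powr real_of_int (k - 1) < h y} y \<partial>N))"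
      by (intro mult_left_mono U) simp
    also have "\<dots> = D * ((ennreal (2 powr (real_of_int k * q)) * ennreal (2 powr (- real_of_int k * r))) *
          (\<integral>\<^sup>+y. ennreal (h y powr r) * indicator {y. 2 powr real_of_int (k - 1) < h y} y \<partial>N))"
      by (simp add: mult_ac)
    also have "ennreal (2 powr (real_of_int k * q)) * ennreal (2 powr (- real_of_int k * r)) = ennreal (2 powr (real_of_int k * d))"
      by (simp add: ennreal_mult[symmetric] powr_add[symmetric] d_def algebra_simps)
    finally show "ennreal (2 powr (real_of_int k * q)) * emeasure M (U k) \<le> D * (\<integral>\<^sup>+y. ennreal (2 powr (real_of_int k * d)) *
        (ennreal (h y powr r) * indicator {y. 2 powr real_of_int (k - 1) < h y} y) \<partial>N)"
      by (simp add: nn_integral_cmult)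
  qed simp
  also have "\<dots> = ennreal (2 powr q) * D * (\<integral>\<^sup>+y. \<integral>\<^sup>+k. ennreal (2 powr (real_of_int k * d)) *
        (ennreal (h y powr r) * indicator {y. 2 powr real_of_int (k - 1) < h y} y) \<partial>count_space UNIV \<partial>N)"
    by (subst nn_integral_count_space_nn_integral) (auto simp: nn_integral_cmult mult.assoc)
  also have "\<dots> \<le> ennreal (2 powr q) * D * (\<integral>\<^sup>+y. ennreal (2 powr q / (1 - 2 powr (- d))) * ennreal (h y powr q) \<partial>N)"
    by (intro mult_left_mono nn_integral_mono pt) simp
  also have "\<dots> = (ennreal (2 powr q) * ennreal (2 powr q / (1 - 2 powr (- d)))) * D * (\<integral>\<^sup>+y. ennreal (h y powr q) \<partial>N)"
    by (subst nn_integral_cmult) (auto simp: mult_ac)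
  also have "ennreal (2 powr q) * ennreal (2 powr q / (1 - 2 powr (- d))) = ennreal (2 powr (2 * q) / (1 - 2 powr (r - q)))"
    using d powr_less_one[of 2 "-d"] by (simp add: ennreal_mult[symmetric] powr_add[symmetric] d_def)
  finally show ?thesis using G_measurable le_G by blast
qed

section \<open>Parabolic balls and dyadic cells\<close>

lemma space_cube_eq_cbox:
  "space_cube x L = cbox (\<chi> i. x $ i - L / 2) (\<chi> i. x $ i + L / 2)"
  unfolding space_cube_def set_eq_iff mem_box_cart mem_Collect_eq vec_lambda_beta abs_diff_le_iff
  by simp

lemma space_cube_borel [measurable]: "space_cube x L \<in> sets borel"
  by (simp add: space_cube_eq_cbox)

lemma emeasure_space_cube:
  assumes "0 \<le> L"
  shows "emeasure lborel (space_cube (x :: real ^ 'n) L) = ennreal (L ^ CARD('n))"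
proof -
  have "cbox (\<chi> i. x $ i - L / 2) (\<chi> i. x $ i + L / 2) \<noteq> {}"
    using assms by (simp add: interval_ne_empty_cart)
  then have "measure lborel (cbox (\<chi> i. x $ i - L / 2) (\<chi> i. x $ i + L / 2)) = L ^ CARD('n)"
    by (subst content_cbox_cart) auto
  moreover have "emeasure lborel (cbox (\<chi> i. x $ i - L / 2) (\<chi> i. x $ i + L / 2)) \<noteq> \<infinity>"
    using emeasure_lborel_cbox_finite by (simp add: less_top)
  ultimately show ?thesis
    by (simp add: space_cube_eq_cbox emeasure_eq_ennreal_measure)
qed

lemma emeasure_lebesgue_Times:
  fixes A :: "'a::euclidean_space set" and B :: "'b::euclidean_space set"
  assumes [measurable]: "A \<in> sets borel" "B \<in> sets borel"
  shows "emeasure lebesgue (A \<times> B) = emeasure lborel A * emeasure lborel B"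
proof -
  have "A \<times> B \<in> sets borel" by (simp add: borel_Times)
  then show ?thesis
    by (simp add: lborel.emeasure_pair_measure_Times lborel_prod[symmetric])
qed

lemma emeasure_cylinder:
  fixes x :: "real ^ 'n"
  assumes "0 \<le> L" "a \<le> b"
  shows "emeasure lebesgue (space_cube x L \<times> {a<..<b}) = ennreal (L ^ CARD('n) * (b - a))"
    and "emeasure lebesgue (space_cube x L \<times> {a..b}) = ennreal (L ^ CARD('n) * (b - a))"
  using assms by (simp_all add: emeasure_lebesgue_Times emeasure_space_cube ennreal_mult)

lemma upper_part_lebesgue [measurable]: "upper_part p \<gamma> x t L \<in> sets lebesgue"
  and lower_part_lebesgue [measurable]: "lower_part p \<gamma> x t L \<in> sets lebesgue"
  unfolding upper_part_def lower_part_def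
  by (auto intro!: sets_completionI_sets borel_Times simp: space_cube_borel)

lemma emeasure_upper_part:
  assumes "0 < L" "\<gamma> < 1"
  shows "emeasure lebesgue (upper_part p \<gamma> (x :: real ^ 'n) t L) = ennreal ((1 - \<gamma>) * (L ^ CARD('n) * L powr p))"
proof -
  have "\<gamma> * L powr p \<le> 1 * L powr p" using assms by (intro mult_right_mono) auto
  then show ?thesis
    using assms unfolding upper_part_def by (subst emeasure_cylinder) (auto simp: algebra_simps)
qed

lemma emeasure_lower_part:
  assumes "0 < L" "\<gamma> < 1"
  shows "emeasure lebesgue (lower_part p \<gamma> (x :: real ^ 'n) t L) = ennreal ((1 - \<gamma>) * (L ^ CARD('n) * L powr p))"
proof -
  have "\<gamma> * L powr p \<le> 1 * L powr p" using assms by (intro mult_right_mono) auto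
  then show ?thesis
    using assms unfolding lower_part_def by (subst emeasure_cylinder) (auto simp: algebra_simps)
qed

section \<open>Parabolic balls and the Vitali covering lemma\<close>

text \<open>For \<open>p \<ge> 1\<close> and nonnegative radius, a closed ball of the metric given
  by the maximum of the sup distance in space and the \<open>1 / p\<close>-th power of the distance
  in time.\<close>

definition parabolic_ball :: "real \<Rightarrow> (real ^ 'n) \<times> real \<Rightarrow> real \<Rightarrow> ((real ^ 'n) \<times> real) set"
  where "parabolic_ball p z \<rho> =
    space_cube (fst z) (2 * \<rho>) \<times> {snd z - \<rho> powr p .. snd z + \<rho> powr p}"

lemma mem_parabolic_ball:
  "y \<in> parabolic_ball p z \<rho> \<longleftrightarrow>
    (\<forall>i. \<bar>fst y $ i - fst z $ i\<bar> \<le> \<rho>) \<and> \<bar>snd y - snd z\<bar> \<le> \<rho> powr p"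
  by (cases y) (auto simp: parabolic_ball_def space_cube_def abs_le_iff)

lemma parabolic_ball_lebesgue [measurable]: "parabolic_ball p z \<rho> \<in> sets lebesgue"
  unfolding parabolic_ball_def
  by (auto intro!: sets_completionI_sets borel_Times simp: space_cube_borel)

lemma emeasure_parabolic_ball:
  "0 \<le> \<rho> \<Longrightarrow> emeasure lebesgue (parabolic_ball p (z :: (real ^ 'n) \<times> real) \<rho>)
    = ennreal ((2 * \<rho>) ^ CARD('n) * (2 * \<rho> powr p))"
  unfolding parabolic_ball_def by (subst emeasure_cylinder) auto

text \<open>The triangle inequality through a common point \<open>u\<close>. In time it gives
  \<open>3 * \<rho> powr p\<close>, which is at most \<open>(3 * \<rho>) powr p\<close> because
  \<open>p \<ge> 1\<close>.\<close>

lemma parabolic_ball_engulf: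
  assumes "1 \<le> p" "0 \<le> \<rho>'" "\<rho>' \<le> \<rho>"
    and "parabolic_ball p z \<rho> \<inter> parabolic_ball p z' \<rho>' \<noteq> {}"
  shows "parabolic_ball p z' \<rho>' \<subseteq> parabolic_ball p z (3 * \<rho>)"
proof
  fix y assume y: "y \<in> parabolic_ball p z' \<rho>'"
  obtain u where u: "u \<in> parabolic_ball p z \<rho>" "u \<in> parabolic_ball p z' \<rho>'"
    using assms by auto
  have "\<bar>fst y $ i - fst z $ i\<bar> \<le> 3 * \<rho>" for i
  proof -
    have "\<bar>fst y $ i - fst z' $ i\<bar> \<le> \<rho>'" "\<bar>fst u $ i - fst z $ i\<bar> \<le> \<rho>" "\<bar>fst u $ i - fst z' $ i\<bar> \<le> \<rho>'"
      using y u by (auto simp: mem_parabolic_ball)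
    then show ?thesis using assms by linarith
  qed
  moreover have "\<bar>snd y - snd z\<bar> \<le> (3 * \<rho>) powr p"
  proof -
    have "\<bar>snd y - snd z'\<bar> \<le> \<rho>' powr p" "\<bar>snd u - snd z\<bar> \<le> \<rho> powr p" "\<bar>snd u - snd z'\<bar> \<le> \<rho>' powr p"
      using y u by (auto simp: mem_parabolic_ball)
    moreover have "\<rho>' powr p \<le> \<rho> powr p" using assms by (intro powr_mono2) auto
    ultimately have "\<bar>snd y - snd z\<bar> \<le> 3 * \<rho> powr p" by linarith
    also have "\<dots> \<le> 3 powr p * \<rho> powr p"
      using powr_mono[of 1 p "3::real"] assms by (intro mult_right_mono) auto
    finally show ?thesis using assms by (simp add: powr_mult)
  qed
  ultimately show "y \<in> parabolic_ball p z (3 * \<rho>)" by (simp add: mem_parabolic_ball)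
qed

text \<open>Greedy selection: keep a ball of largest radius, discard all balls meeting it, which lie
  in its triple by engulfing, and recurse on the rest.\<close>

lemma Vitali_parabolic_balls:
  fixes z :: "'i \<Rightarrow> (real ^ 'n) \<times> real"
  assumes "1 \<le> p" "finite I" "\<And>i. i \<in> I \<Longrightarrow> 0 \<le> \<rho> i"
  shows "\<exists>J\<subseteq>I. disjoint_family_on (\<lambda>j. parabolic_ball p (z j) (\<rho> j)) J \<and>
    (\<forall>i\<in>I. \<exists>j\<in>J. parabolic_ball p (z i) (\<rho> i) \<subseteq> parabolic_ball p (z j) (3 * \<rho> j))"
  using assms(2,3)
proof (induction I rule: finite_psubset_induct)
  case (psubset I)
  let ?B = "\<lambda>i. parabolic_ball p (z i) (\<rho> i)"
  show ?case
  proof (cases "I = {}")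
    case True
    then show ?thesis by (simp add: disjoint_family_on_def)
  next
    case False
    have fin: "finite (\<rho> ` I)" using psubset by simp
    then have "Max (\<rho> ` I) \<in> \<rho> ` I" using False by (intro Max_in) auto
    then obtain j where j: "j \<in> I" "\<rho> j = Max (\<rho> ` I)" by auto
    have max: "\<rho> i \<le> \<rho> j" if "i \<in> I" for i
      using that fin unfolding j(2) by (intro Max_ge) auto
    define I' where "I' = {i\<in>I. ?B j \<inter> ?B i = {}}"
    \<comment> \<open>A ball contains its own centre, so \<open>j\<close> is discarded as well and
      the recursion is on a strictly smaller set.\<close>
    have "z j \<in> ?B j" using psubset.prems j(1) by (auto simp: mem_parabolic_ball)
    then have "I' \<subset> I" using j unfolding I'_def by blast
    with psubset.IH[of I'] psubset.prems obtain J where J: "J \<subseteq> I'" "disjoint_family_on ?B J"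
      and cov: "\<And>i. i \<in> I' \<Longrightarrow> \<exists>j\<in>J. ?B i \<subseteq> parabolic_ball p (z j) (3 * \<rho> j)"
      by (metis (no_types, lifting) psubsetD)
    have "disjoint_family_on ?B (insert j J)"
      using J unfolding disjoint_family_on_def I'_def by fast
    moreover have "\<exists>j\<in>insert j J. ?B i \<subseteq> parabolic_ball p (z j) (3 * \<rho> j)" if "i \<in> I" for i
    proof (cases "i \<in> I'")
      case True
      then show ?thesis using cov by blast
    next
      case False
      then have "?B j \<inter> ?B i \<noteq> {}" using that by (auto simp: I'_def)
      then have "?B i \<subseteq> parabolic_ball p (z j) (3 * \<rho> j)"
        using assms(1) psubset.prems max that by (intro parabolic_ball_engulf) auto
      then show ?thesis by blast
    qed
    moreover have "insert j J \<subseteq> I" using j J by (auto simp: I'_def)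
    ultimately show ?thesis by blast
  qed
qed

text \<open>Rounding the time exponent \<open>k * p\<close> down to an integer keeps the cells nested in \<open>k\<close>, at the
  cost of a factor \<open>2\<close> in their height.\<close>

definition cell :: "real \<Rightarrow> int \<Rightarrow> (real ^ 'n) \<times> real \<Rightarrow> ((real ^ 'n) \<times> real) set"
  where "cell p k z =
    {y. (\<forall>i. \<lfloor>fst y $ i / 2 powr real_of_int k\<rfloor> = \<lfloor>fst z $ i / 2 powr real_of_int k\<rfloor>) \<and>
      \<lfloor>snd y / 2 powr real_of_int \<lfloor>real_of_int k * p\<rfloor>\<rfloor> = \<lfloor>snd z / 2 powr real_of_int \<lfloor>real_of_int k * p\<rfloor>\<rfloor>}"

section \<open>Nesting, countability and size of the cells\<close>

text \<open>The coarser scale is an integer multiple of the finer one, so the coarse floor is an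
  integer quotient of the fine floor.\<close>

lemma floor_dyadic_coarsen:
  fixes x y :: real and k m :: int
  assumes "k \<le> m" "\<lfloor>x / 2 powr real_of_int k\<rfloor> = \<lfloor>y / 2 powr real_of_int k\<rfloor>"
  shows "\<lfloor>x / 2 powr real_of_int m\<rfloor> = \<lfloor>y / 2 powr real_of_int m\<rfloor>"
proof -
  have "2 powr real_of_int m = 2 powr real_of_int k * 2 powr real_of_int (m - k)"
    by (simp add: powr_add[symmetric])
  also have "2 powr real_of_int (m - k) = real_of_int (2 ^ nat (m - k))"
    using assms powr_realpow[of 2 "nat (m - k)"] by simp
  finally have eq: "u / 2 powr real_of_int m = u / 2 powr real_of_int k / real_of_int (2 ^ nat (m - k))" for u
    by simp
  show ?thesis
    unfolding eq by (subst (1 2) floor_divide_real_eq_div) (use assms in auto)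
qed

lemma mem_cell_self: "z \<in> cell p k z"
  by (simp add: cell_def)

lemma cell_eq: "y \<in> cell p k z \<Longrightarrow> cell p k y = cell p k z"
  by (simp add: cell_def)

lemma cell_mono:
  assumes "0 \<le> p" "k \<le> m"
  shows "cell p k z \<subseteq> cell p m z"
proof -
  have "\<lfloor>real_of_int k * p\<rfloor> \<le> \<lfloor>real_of_int m * p\<rfloor>"
    using assms by (intro floor_mono mult_right_mono) auto
  then show ?thesis
    using assms floor_dyadic_coarsen unfolding cell_def by blast
qed

text \<open>Two cells with a common point \<open>u\<close> are both cells of \<open>u\<close>, and
  those form a chain ordered by level.\<close>

lemma cells_nested:
  assumes "0 \<le> p"
  shows "cell p k z \<inter> cell p m y = {} \<or> cell p k z \<subseteq> cell p m y \<or> cell p m y \<subseteq> cell p k z"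
proof (cases "cell p k z \<inter> cell p m y = {}")
  case False
  then obtain u where u: "cell p k u = cell p k z" "cell p m u = cell p m y"
    using cell_eq by blast
  show ?thesis
    using cell_mono[OF assms, of k m u] cell_mono[OF assms, of m k u] u by (cases "k \<le> m") auto
qed simp

text \<open>A cell is determined by its level and the integer values of the floors, which is
  countable data.\<close>

lemma countable_cells: "countable {cell p k z |k (z :: (real ^ 'n) \<times> real). True}"
proof -
  define G where "G = (\<lambda>(k, c, j). {y :: (real ^ 'n) \<times> real.
      (\<forall>i. \<lfloor>fst y $ i / 2 powr real_of_int k\<rfloor> = c $ i) \<and>
      \<lfloor>snd y / 2 powr real_of_int \<lfloor>real_of_int k * p\<rfloor>\<rfloor> = j})"
  have "cell p k z = G (k, \<chi> i. \<lfloor>fst z $ i / 2 powr real_of_int k\<rfloor>,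
      \<lfloor>snd z / 2 powr real_of_int \<lfloor>real_of_int k * p\<rfloor>\<rfloor>)" for k and z :: "(real ^ 'n) \<times> real"
    by (simp add: G_def cell_def)
  then have "{cell p k z |k (z :: (real ^ 'n) \<times> real). True} \<subseteq> range G" by blast
  then show ?thesis by (rule countable_subset) auto
qed

lemma cell_lebesgue [measurable]: "cell p k z \<in> sets lebesgue"
proof -
  have [measurable]: "(\<lambda>y :: (real ^ 'n) \<times> real. fst y $ i) \<in> borel_measurable borel" for i
    by (intro borel_measurable_continuous_onI continuous_intros)
  have [measurable]: "(\<lambda>y :: (real ^ 'n) \<times> real. snd y) \<in> borel_measurable borel"
    by (intro borel_measurable_continuous_onI continuous_intros)
  have "{y \<in> space borel. (\<forall>i. \<lfloor>fst y $ i / 2 powr real_of_int k\<rfloor> = \<lfloor>fst z $ i / 2 powr real_of_int k\<rfloor>) \<and>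
      \<lfloor>snd y / 2 powr real_of_int \<lfloor>real_of_int k * p\<rfloor>\<rfloor> = \<lfloor>snd z / 2 powr real_of_int \<lfloor>real_of_int k * p\<rfloor>\<rfloor>} \<in> sets borel"
    by measurable
  then show ?thesis by (auto simp: cell_def intro!: sets_completionI_sets)
qed

lemma cell_near:
  assumes "y \<in> cell p k z"
  shows "\<bar>fst y $ i - fst z $ i\<bar> < 2 powr real_of_int k"
    and "\<bar>snd y - snd z\<bar> < (2 powr real_of_int k) powr p"
proof -
  have near: "\<bar>u - v\<bar> < l" if "\<lfloor>u / l\<rfloor> = \<lfloor>v / l\<rfloor>" "0 < l" for u v l :: real
  proof -
    have "\<bar>u / l - v / l\<bar> < 1" using that(1) by linarith
    then show ?thesis using that(2) by (simp add: diff_divide_distrib[symmetric])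
  qed
  show "\<bar>fst y $ i - fst z $ i\<bar> < 2 powr real_of_int k"
    using assms by (intro near) (auto simp: cell_def)
  have "\<bar>snd y - snd z\<bar> < 2 powr real_of_int \<lfloor>real_of_int k * p\<rfloor>"
    using assms by (intro near) (auto simp: cell_def)
  also have "\<dots> \<le> (2 powr real_of_int k) powr p" by (simp add: powr_powr)
  finally show "\<bar>snd y - snd z\<bar> < (2 powr real_of_int k) powr p" .
qed

text \<open>In space the half-open cell is compared with the concentric closed cube of half the
  side, in time with its open interior. The factor \<open>1 / 2\<close> on the time side pays for
  rounding the exponent.\<close>

lemma emeasure_cell_ge:
  fixes z :: "(real ^ 'n) \<times> real"
  shows "ennreal ((2 powr real_of_int k / 2) ^ CARD('n) * ((2 powr real_of_int k) powr p / 2))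
    \<le> emeasure lebesgue (cell p k z)"
proof -
  define l where "l = 2 powr real_of_int k"
  define \<tau> where "\<tau> = 2 powr real_of_int \<lfloor>real_of_int k * p\<rfloor>"
  have pos: "0 < l" "0 < \<tau>" by (auto simp: l_def \<tau>_def)
  define c where "c = (\<chi> i. (real_of_int \<lfloor>fst z $ i / l\<rfloor> + 1 / 2) * l)"
  define j where "j = real_of_int \<lfloor>snd z / \<tau>\<rfloor>"
  have fl: "\<lfloor>u / m\<rfloor> = a" if "0 < m" "real_of_int a * m \<le> u" "u < (real_of_int a + 1) * m"
    for u m and a :: int
    using that by (intro floor_unique) (auto simp: field_simps)
  have "space_cube c (l / 2) \<times> {j * \<tau> <..< (j + 1) * \<tau>} \<subseteq> cell p k z"
  proof
    fix y assume y: "y \<in> space_cube c (l / 2) \<times> {j * \<tau> <..< (j + 1) * \<tau>}"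
    have "\<lfloor>fst y $ i / l\<rfloor> = \<lfloor>fst z $ i / l\<rfloor>" for i
    proof (rule fl)
      have "\<bar>fst y $ i - (real_of_int \<lfloor>fst z $ i / l\<rfloor> + 1 / 2) * l\<bar> \<le> l / 4"
        using y by (auto simp: space_cube_def c_def)
      then show "real_of_int \<lfloor>fst z $ i / l\<rfloor> * l \<le> fst y $ i"
          "fst y $ i < (real_of_int \<lfloor>fst z $ i / l\<rfloor> + 1) * l"
        using pos unfolding distrib_right abs_le_iff by auto
    qed (use pos in auto)
    moreover have "\<lfloor>snd y / \<tau>\<rfloor> = \<lfloor>snd z / \<tau>\<rfloor>"
      using y pos by (intro fl) (auto simp: j_def)
    ultimately show "y \<in> cell p k z" by (simp add: cell_def l_def \<tau>_def)
  qed
  then have "emeasure lebesgue (space_cube c (l / 2) \<times> {j * \<tau> <..< (j + 1) * \<tau>})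
      \<le> emeasure lebesgue (cell p k z)"
    by (intro emeasure_mono) auto
  moreover have "emeasure lebesgue (space_cube c (l / 2) \<times> {j * \<tau> <..< (j + 1) * \<tau>}) = ennreal ((l / 2) ^ CARD('n) * \<tau>)"
    using pos by (subst emeasure_cylinder) (auto simp: algebra_simps)
  moreover have "(2 powr real_of_int k) powr p / 2 \<le> \<tau>"
  proof -
    have "(2 powr real_of_int k) powr p / 2 = 2 powr (real_of_int k * p - 1)"
      by (simp add: powr_powr powr_diff)
    also have "\<dots> \<le> \<tau>" unfolding \<tau>_def by (intro powr_mono) linarith+
    finally show ?thesis .
  qed
  then have "ennreal ((l / 2) ^ CARD('n) * ((2 powr real_of_int k) powr p / 2)) \<le> ennreal ((l / 2) ^ CARD('n) * \<tau>)"
    using pos by (intro ennreal_leI mult_left_mono) auto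
  ultimately show ?thesis by (simp add: l_def)
qed

section \<open>Comparison of cells, balls and the two parts of a rectangle\<close>

text \<open>Take the dyadic scale just below \<open>\<eta> * L\<close>. Points of the cell are then
  within \<open>L / 2\<close> of the centre in space, and in time within
  \<open>(\<eta> * L) powr p \<le> \<eta> * L powr p\<close>, by \<open>p \<ge> 1\<close> and
  \<open>\<eta> \<le> 1\<close>. The scale is at least \<open>\<eta> * L / 2\<close>, which makes
  the two measures comparable.\<close>

lemma lower_part_contains_cell:
  fixes x :: "real ^ 'n"
  assumes "1 \<le> p" "0 \<le> \<gamma>" "\<gamma> < 1" "0 < L"
  shows "\<exists>k. cell p k (lower_center p \<gamma> x t L) \<subseteq> lower_part p \<gamma> x t L \<and>
    ennreal (((1 - \<gamma>) / 8) ^ CARD('n) * ((1 - \<gamma>) / 4) powr p / 2) *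
      emeasure lebesgue (lower_part p \<gamma> x t L)
      \<le> emeasure lebesgue (cell p k (lower_center p \<gamma> x t L))"
proof -
  \<comment> \<open>\<open>\<eta> * L powr p\<close> is half the height of the lower part, hence the
    time distance from its centre to its boundary.\<close>
  define \<eta> where "\<eta> = (1 - \<gamma>) / 2"
  define z where "z = lower_center p \<gamma> x t L"
  have \<eta>: "0 < \<eta>" "\<eta> \<le> 1 / 2" using assms by (auto simp: \<eta>_def)
  obtain k :: int where k: "2 powr real_of_int k < \<eta> * L" "\<eta> * L \<le> 2 powr real_of_int (k + 1)"
    using obtain_dyadic_above[of "\<eta> * L"] \<eta> assms by auto
  have z: "fst z = x" "snd z = t - (1 + \<gamma>) / 2 * L powr p"
    by (auto simp: z_def lower_center_def midpoint_def field_simps)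
  have "cell p k z \<subseteq> lower_part p \<gamma> x t L"
  proof
    fix y assume "y \<in> cell p k z"
    note near = cell_near[OF this]
    have "(2 powr real_of_int k) powr p \<le> (\<eta> * L) powr p"
      using k assms by (intro powr_mono2) auto
    also have "\<dots> = \<eta> powr p * L powr p" using \<eta> assms by (simp add: powr_mult)
    also have "\<dots> \<le> \<eta> powr 1 * L powr p"
      using \<eta> assms by (intro mult_right_mono powr_mono') auto
    finally have "\<bar>snd y - snd z\<bar> < \<eta> * L powr p" using near(2) \<eta> by simp
    then have "2 * \<bar>snd y - snd z\<bar> < L powr p - \<gamma> * L powr p"
      by (simp add: \<eta>_def algebra_simps)
    moreover have "2 * snd z = 2 * t - L powr p - \<gamma> * L powr p"
      unfolding z by (simp add: field_simps)
    moreover have "t - P < s \<and> s < t - G" if "2 * \<bar>s - u\<bar> < P - G" "2 * u = 2 * t - P - G"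
      for s u P G :: real
      using that by (smt (verit))
    ultimately have "t - L powr p < snd y \<and> snd y < t - \<gamma> * L powr p" by blast
    then have "snd y \<in> {t - L powr p <..< t - \<gamma> * L powr p}" by simp
    moreover have "\<bar>fst y $ i - x $ i\<bar> \<le> L / 2" for i
    proof -
      have "\<eta> * L \<le> 1 / 2 * L" using \<eta> assms by (intro mult_right_mono) auto
      then show ?thesis using near(1)[of i] k z by simp
    qed
    ultimately show "y \<in> lower_part p \<gamma> x t L"
      by (cases y) (auto simp: lower_part_def space_cube_def)
  qed
  moreover have "ennreal (((1 - \<gamma>) / 8) ^ CARD('n) * ((1 - \<gamma>) / 4) powr p / 2) *
      emeasure lebesgue (lower_part p \<gamma> x t L) \<le> emeasure lebesgue (cell p k z)"
  proof -
    have pow: "(\<eta> / 2 * L / 2) ^ CARD('n) = (\<eta> / 4) ^ CARD('n) * L ^ CARD('n)"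
      by (simp flip: power_mult_distrib)
    have pw: "(\<eta> / 2 * L) powr p = (\<eta> / 2) powr p * L powr p"
      by (rule powr_mult)
    have half: "\<eta> / 2 * L \<le> 2 powr real_of_int k" using k by (simp add: powr_add)
    have "ennreal (((1 - \<gamma>) / 8) ^ CARD('n) * ((1 - \<gamma>) / 4) powr p / 2) *
        emeasure lebesgue (lower_part p \<gamma> x t L)
      = ennreal ((\<eta> / 4) ^ CARD('n) * (\<eta> / 2) powr p / 2) * ennreal ((1 - \<gamma>) * (L ^ CARD('n) * L powr p))"
      using assms by (subst emeasure_lower_part) (auto simp: \<eta>_def)
    also have "\<dots> = ennreal ((\<eta> / 4) ^ CARD('n) * (\<eta> / 2) powr p / 2 * ((1 - \<gamma>) * (L ^ CARD('n) * L powr p)))"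
      using \<eta> assms by (intro ennreal_mult[symmetric]) auto
    also have "(\<eta> / 4) ^ CARD('n) * (\<eta> / 2) powr p / 2 * ((1 - \<gamma>) * (L ^ CARD('n) * L powr p))
      = (1 - \<gamma>) * ((\<eta> / 2 * L / 2) ^ CARD('n) * ((\<eta> / 2 * L) powr p / 2))"
      unfolding pow pw by (simp add: mult_ac)
    \<comment> \<open>The factor \<open>1 - \<gamma>\<close> is at most one and is dropped.\<close>
    also have "\<dots> \<le> 1 * ((2 powr real_of_int k / 2) ^ CARD('n) * ((2 powr real_of_int k) powr p / 2))"
    proof (intro mult_mono)
      show "(\<eta> / 2 * L / 2) ^ CARD('n) \<le> (2 powr real_of_int k / 2) ^ CARD('n)"
        using \<eta> assms by (intro power_mono divide_right_mono half) auto
      have "(\<eta> / 2 * L) powr p \<le> (2 powr real_of_int k) powr p"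
        using \<eta> assms by (intro powr_mono2 half) auto
      then show "(\<eta> / 2 * L) powr p / 2 \<le> (2 powr real_of_int k) powr p / 2"
        by (rule divide_right_mono) simp
    qed (use \<eta> assms in auto)
    finally have "ennreal (((1 - \<gamma>) / 8) ^ CARD('n) * ((1 - \<gamma>) / 4) powr p / 2) *
        emeasure lebesgue (lower_part p \<gamma> x t L)
      \<le> ennreal (1 * ((2 powr real_of_int k / 2) ^ CARD('n) * ((2 powr real_of_int k) powr p / 2)))"
      using ennreal_leI by blast
    then show ?thesis using emeasure_cell_ge[of k p z] unfolding mult_1 by (rule order_trans)
  qed
  ultimately show ?thesis unfolding z_def by blast
qed

text \<open>A ball about the centre of the rectangle holds both parts whatever the lag, so a cell in
  the lower part shares a ball of comparable size with the upper part.\<close>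

lemma parts_subset_parabolic_ball:
  assumes "1 \<le> p" "0 \<le> \<gamma>" "\<gamma> < 1" "0 < L"
  shows "upper_part p \<gamma> x t L \<subseteq> parabolic_ball p (x, t) L"
    and "lower_part p \<gamma> x t L \<subseteq> parabolic_ball p (x, t) L"
proof -
  have "\<bar>u\<bar> \<le> L" if "\<bar>u\<bar> \<le> L / 2" for u using that assms by simp
  moreover have "0 \<le> \<gamma> * L powr p" using assms by simp
  ultimately show "upper_part p \<gamma> x t L \<subseteq> parabolic_ball p (x, t) L"
    and "lower_part p \<gamma> x t L \<subseteq> parabolic_ball p (x, t) L"
    by (auto simp: mem_parabolic_ball upper_part_def lower_part_def space_cube_def)
qed

text \<open>The triple radius is the one produced by the covering lemma; the denominator
  \<open>1 - \<gamma>\<close> reflects the thinness of the upper part.\<close>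

lemma emeasure_parabolic_ball_le:
  fixes x :: "real ^ 'n"
  assumes "\<gamma> < 1" "0 < L"
  shows "emeasure lebesgue (parabolic_ball p (x, t) (3 * L))
    = ennreal (6 ^ CARD('n) * (2 * 3 powr p) / (1 - \<gamma>)) * emeasure lebesgue (upper_part p \<gamma> x t L)"
  unfolding emeasure_upper_part[OF assms(2,1)] using assms
  by (subst emeasure_parabolic_ball) (auto simp: ennreal_mult[symmetric] powr_mult power_mult_distrib)

section \<open>Averages\<close>

text \<open>Averages become integrals against a single measure, a probability measure when
  \<open>A\<close> has positive finite measure, so inequalities for general measures apply to them
  directly.\<close>

lemma average_eq_uniform_measure:
  assumes "g \<in> borel_measurable lebesgue" "A \<in> sets lebesgue"
  shows "average A g = (\<integral>\<^sup>+z. g z \<partial>uniform_measure lebesgue A)"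
  using assms unfolding average_def by (simp add: nn_integral_uniform_measure)

lemma average_mult_emeasure:
  assumes "emeasure lebesgue A \<noteq> 0" "emeasure lebesgue A \<noteq> \<infinity>"
  shows "average A g * emeasure lebesgue A = (\<integral>\<^sup>+z\<in>A. g z \<partial>lebesgue)"
proof -
  have "emeasure lebesgue A / emeasure lebesgue A = 1"
    using assms by (intro ennreal_divide_self) (auto simp: less_top[symmetric])
  then show ?thesis unfolding average_def by (simp only: ennreal_divide_times mult_1_right)
qed

text \<open>The values of \<open>h\<close> up to \<open>c / 2\<close> contribute at most
  \<open>c / 2\<close> to the average, so the larger values must contribute the rest.\<close>

lemma average_truncation:
  fixes h :: "'a::euclidean_space \<Rightarrow> real"
  assumes [measurable]: "h \<in> borel_measurable lebesgue" "A \<in> sets lebesgue"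
    and "emeasure lebesgue A \<noteq> 0" "emeasure lebesgue A \<noteq> \<infinity>" "0 < c"
    and less: "ennreal c < average A (\<lambda>z. ennreal (h z))"
  shows "ennreal (c / 2) \<le> average A (\<lambda>z. ennreal (h z) * indicator {z. c / 2 < h z} z)"
proof -
  let ?M = "uniform_measure lebesgue A"
  have mass: "emeasure ?M (space ?M) = 1"
  proof -
    have "emeasure ?M (space ?M) = emeasure lebesgue A / emeasure lebesgue A"
      by (subst emeasure_uniform_measure) auto
    also have "\<dots> = 1"
      using assms by (intro ennreal_divide_self) (auto simp: less_top[symmetric])
    finally show ?thesis .
  qed
  define I where "I = (\<integral>\<^sup>+z. ennreal (h z) * indicator {z. c / 2 < h z} z \<partial>?M)"
  have "ennreal c < (\<integral>\<^sup>+z. ennreal (h z) \<partial>?M)"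
    using less by (subst (asm) average_eq_uniform_measure) auto
  also have "\<dots> \<le> (\<integral>\<^sup>+z. ennreal (c / 2) + ennreal (h z) * indicator {z. c / 2 < h z} z \<partial>?M)"
    by (intro nn_integral_mono) (auto simp: indicator_def ennreal_leI not_less)
  also have "\<dots> = ennreal (c / 2) + I"
    unfolding I_def using mass by (subst nn_integral_add) auto
  finally have "ennreal c < ennreal (c / 2) + I" .
  moreover have "ennreal c = ennreal (c / 2) + ennreal (c / 2)"
    using \<open>0 < c\<close> by (subst ennreal_plus[symmetric]) auto
  ultimately have lt: "ennreal (c / 2) + ennreal (c / 2) < ennreal (c / 2) + I" by metis
  have "ennreal (c / 2) \<le> I"
  proof (rule ccontr)
    assume "\<not> ennreal (c / 2) \<le> I"
    then have "I \<le> ennreal (c / 2)" by (meson le_cases)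
    then have "ennreal (c / 2) + I \<le> ennreal (c / 2) + ennreal (c / 2)" by (rule add_left_mono)
    with lt show False by (meson leD)
  qed
  also have "I = average A (\<lambda>z. ennreal (h z) * indicator {z. c / 2 < h z} z)"
    unfolding I_def by (subst average_eq_uniform_measure) auto
  finally show ?thesis .
qed

section \<open>Weak type bound and sums of averages\<close>

text \<open>The Hardy--Littlewood weak type (1,1) argument, with \<open>h\<close> large on sets
  \<open>D i\<close> that fill a fixed fraction of their balls. After Vitali selection the chosen
  \<open>D j\<close> are disjoint, so their integrals add up to at most the full integral.\<close>

lemma weak_type_parabolic_balls:
  fixes z :: "'i \<Rightarrow> (real ^ 'n) \<times> real" and h :: "(real ^ 'n) \<times> real \<Rightarrow> ennreal"
  assumes "1 \<le> p" "finite I" "0 < c"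
    and [measurable]: "h \<in> borel_measurable lebesgue" "\<And>i. i \<in> I \<Longrightarrow> D i \<in> sets lebesgue"
    and \<rho>: "\<And>i. i \<in> I \<Longrightarrow> 0 \<le> \<rho> i"
    and sub: "\<And>i. i \<in> I \<Longrightarrow> D i \<subseteq> parabolic_ball p (z i) (\<rho> i)"
    and size: "\<And>i. i \<in> I \<Longrightarrow> emeasure lebesgue (parabolic_ball p (z i) (3 * \<rho> i)) \<le> A * emeasure lebesgue (D i)"
    and large: "\<And>i. i \<in> I \<Longrightarrow> ennreal c * emeasure lebesgue (D i) \<le> (\<integral>\<^sup>+y\<in>D i. h y \<partial>lebesgue)"
  shows "emeasure lebesgue (\<Union>i\<in>I. parabolic_ball p (z i) (\<rho> i))
    \<le> A * ennreal (1 / c) * (\<integral>\<^sup>+y. h y \<partial>lebesgue)"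
proof -
  have "\<exists>J\<subseteq>I. disjoint_family_on (\<lambda>j. parabolic_ball p (z j) (\<rho> j)) J \<and>
      (\<forall>i\<in>I. \<exists>j\<in>J. parabolic_ball p (z i) (\<rho> i) \<subseteq> parabolic_ball p (z j) (3 * \<rho> j))"
    using assms(1,2) \<rho> by (rule Vitali_parabolic_balls)
  then obtain J where J: "J \<subseteq> I" and disj: "disjoint_family_on (\<lambda>j. parabolic_ball p (z j) (\<rho> j)) J"
    and cov: "\<And>i. i \<in> I \<Longrightarrow> \<exists>j\<in>J. parabolic_ball p (z i) (\<rho> i) \<subseteq> parabolic_ball p (z j) (3 * \<rho> j)"
    by (elim exE conjE) simp
  have fin: "finite J" using J assms(2) by (rule finite_subset)
  have [measurable]: "D j \<in> sets lebesgue" if "j \<in> J" for j using that J assms(5) by auto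
  have disjD: "disjoint_family_on D J"
    using disj sub J unfolding disjoint_family_on_def by blast
  have "emeasure lebesgue (\<Union>i\<in>I. parabolic_ball p (z i) (\<rho> i))
      \<le> emeasure lebesgue (\<Union>j\<in>J. parabolic_ball p (z j) (3 * \<rho> j))"
    using cov fin by (intro emeasure_mono) (auto intro!: sets.finite_UN)
  also have "\<dots> \<le> (\<Sum>j\<in>J. emeasure lebesgue (parabolic_ball p (z j) (3 * \<rho> j)))"
    using fin by (intro emeasure_subadditive_finite) auto
  also have "\<dots> \<le> (\<Sum>j\<in>J. A * ennreal (1 / c) * (\<integral>\<^sup>+y\<in>D j. h y \<partial>lebesgue))"
  proof (rule sum_mono)
    fix j assume "j \<in> J"
    then have "j \<in> I" using J by auto
    have "emeasure lebesgue (parabolic_ball p (z j) (3 * \<rho> j)) \<le> A * emeasure lebesgue (D j)"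
      using size[OF \<open>j \<in> I\<close>] .
    also have "\<dots> = A * ennreal (1 / c) * (ennreal c * emeasure lebesgue (D j))"
    proof -
      have "ennreal (1 / c) * ennreal c = 1" using \<open>0 < c\<close> by (simp flip: ennreal_mult)
      moreover have "A * ennreal (1 / c) * (ennreal c * emeasure lebesgue (D j))
          = A * ((ennreal (1 / c) * ennreal c) * emeasure lebesgue (D j))"
        by (simp only: mult.assoc)
      ultimately show ?thesis by simp
    qed
    also have "\<dots> \<le> A * ennreal (1 / c) * (\<integral>\<^sup>+y\<in>D j. h y \<partial>lebesgue)"
      by (intro mult_left_mono large \<open>j \<in> I\<close>) simp
    finally show "emeasure lebesgue (parabolic_ball p (z j) (3 * \<rho> j)) \<le> A * ennreal (1 / c) * (\<integral>\<^sup>+y\<in>D j. h y \<partial>lebesgue)" .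
  qed
  also have "\<dots> = A * ennreal (1 / c) * (\<Sum>j\<in>J. \<integral>\<^sup>+y\<in>D j. h y \<partial>lebesgue)"
    by (simp add: sum_distrib_left)
  also have "\<dots> \<le> A * ennreal (1 / c) * (\<integral>\<^sup>+y. h y \<partial>lebesgue)"
  proof (rule mult_left_mono)
    have "(\<Sum>j\<in>J. \<integral>\<^sup>+y\<in>D j. h y \<partial>lebesgue) = (\<integral>\<^sup>+y. (\<Sum>j\<in>J. h y * indicator (D j) y) \<partial>lebesgue)"
      by (rule nn_integral_sum[symmetric]) measurable
    also have "\<dots> \<le> (\<integral>\<^sup>+y. h y \<partial>lebesgue)"
    proof (rule nn_integral_mono)
      fix y
      have "(\<Sum>j\<in>J. h y * indicator (D j) y) = h y * indicator (\<Union>j\<in>J. D j) y"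
        using fin disjD by (simp add: indicator_UN_disjoint sum_distrib_left)
      also have "\<dots> \<le> h y" by (simp add: indicator_def)
      finally show "(\<Sum>j\<in>J. h y * indicator (D j) y) \<le> h y" .
    qed
    finally show "(\<Sum>j\<in>J. \<integral>\<^sup>+y\<in>D j. h y \<partial>lebesgue) \<le> (\<integral>\<^sup>+y. h y \<partial>lebesgue)" .
  qed simp
  finally show ?thesis .
qed

text \<open>The sum is dominated by the integral of \<open>F\<close> to the power \<open>b\<close>,
  where \<open>F\<close> is the step function equal to the average over \<open>D i\<close> on the
  disjoint sets \<open>K i\<close>. A level set of \<open>F\<close> lies in balls whose
  \<open>D i\<close> carry a large average, so \<open>F\<close> obeys a weak type (1,1) bound, and
  interpolation applies since \<open>b > 1\<close>. The sets \<open>D i\<close> may overlap.\<close>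

lemma disjoint_averages_bound:
  fixes z :: "'i \<Rightarrow> (real ^ 'n) \<times> real" and h :: "(real ^ 'n) \<times> real \<Rightarrow> real"
  assumes "1 \<le> p" "finite I" "1 < b"
    and [measurable]: "h \<in> borel_measurable lebesgue" and h: "\<And>y. 0 \<le> h y"
    and D [measurable]: "\<And>i. i \<in> I \<Longrightarrow> D i \<in> sets lebesgue"
    and D_fin: "\<And>i. i \<in> I \<Longrightarrow> emeasure lebesgue (D i) \<noteq> 0" "\<And>i. i \<in> I \<Longrightarrow> emeasure lebesgue (D i) \<noteq> \<infinity>"
    and K [measurable]: "\<And>i. i \<in> I \<Longrightarrow> K i \<in> sets lebesgue"
    and disj: "disjoint_family_on K I"
    and \<rho>: "\<And>i. i \<in> I \<Longrightarrow> 0 \<le> \<rho> i"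
    and sub: "\<And>i. i \<in> I \<Longrightarrow> D i \<subseteq> parabolic_ball p (z i) (\<rho> i)"
      "\<And>i. i \<in> I \<Longrightarrow> K i \<subseteq> parabolic_ball p (z i) (\<rho> i)"
    and size: "\<And>i. i \<in> I \<Longrightarrow> emeasure lebesgue (parabolic_ball p (z i) (3 * \<rho> i)) \<le> A * emeasure lebesgue (D i)"
  shows "(\<Sum>i\<in>I. ennreal_powr (average (D i) (\<lambda>y. ennreal (h y))) b * emeasure lebesgue (K i))
    \<le> ennreal (2 powr (2 * b) / (1 - 2 powr (1 - b))) * (A * 2) * (\<integral>\<^sup>+y. ennreal (h y powr b) \<partial>lebesgue)"
proof -
  define \<alpha> where "\<alpha> i = average (D i) (\<lambda>y. ennreal (h y))" for i
  define F where "F y = (\<Sum>i\<in>I. \<alpha> i * indicator (K i) y)" for y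
  have F_in: "F y = \<alpha> i" if "i \<in> I" "y \<in> K i" for i y
  proof -
    have "y \<notin> K j" if "j \<in> I" "j \<noteq> i" for j
      using disj that \<open>i \<in> I\<close> \<open>y \<in> K i\<close> unfolding disjoint_family_on_def by blast
    then have "F y = (\<Sum>j\<in>I. if j = i then \<alpha> i else 0)"
      unfolding F_def using \<open>y \<in> K i\<close> by (intro sum.cong) (auto simp: indicator_def)
    then show ?thesis using \<open>i \<in> I\<close> assms(2) by simp
  qed
  have "(\<Sum>i\<in>I. ennreal_powr (\<alpha> i) b * emeasure lebesgue (K i))
      = (\<integral>\<^sup>+y. (\<Sum>i\<in>I. ennreal_powr (\<alpha> i) b * indicator (K i) y) \<partial>lebesgue)"
    by (subst nn_integral_sum) (auto simp: nn_integral_cmult)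
  also have "\<dots> \<le> (\<integral>\<^sup>+y. ennreal_powr (F y) b \<partial>lebesgue)"
  proof (rule nn_integral_mono)
    fix y
    show "(\<Sum>i\<in>I. ennreal_powr (\<alpha> i) b * indicator (K i) y) \<le> ennreal_powr (F y) b"
    proof (cases "\<exists>i\<in>I. y \<in> K i")
      case True
      then obtain i where i: "i \<in> I" "y \<in> K i" by blast
      have "y \<notin> K j" if "j \<in> I" "j \<noteq> i" for j
        using disj that i unfolding disjoint_family_on_def by blast
      then have "(\<Sum>j\<in>I. ennreal_powr (\<alpha> j) b * indicator (K j) y) = (\<Sum>j\<in>I. if j = i then ennreal_powr (\<alpha> i) b else 0)"
        using i by (intro sum.cong) (auto simp: indicator_def)
      then show ?thesis using i assms(2) F_in[OF i] by simp
    next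
      case False
      then have "(\<Sum>i\<in>I. ennreal_powr (\<alpha> i) b * indicator (K i) y) = 0"
        by (intro sum.neutral) auto
      then show ?thesis by simp
    qed
  qed
  also have "\<dots> \<le> ennreal (2 powr (2 * b) / (1 - 2 powr (1 - b))) * (A * 2) * (\<integral>\<^sup>+y. ennreal (h y powr b) \<partial>lebesgue)"
  proof -
    have "\<exists>G\<in>borel_measurable lebesgue. (\<forall>y\<in>space lebesgue. ennreal_powr (F y) b \<le> G y) \<and>
      (\<integral>\<^sup>+y. G y \<partial>lebesgue) \<le> ennreal (2 powr (2 * b) / (1 - 2 powr (1 - b))) * (A * 2) * (\<integral>\<^sup>+y. ennreal (h y powr b) \<partial>lebesgue)"
    \<comment> \<open>Weak type (1,1) is applied to the part of \<open>h\<close> above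
      \<open>c / 2\<close>, whose averages still exceed \<open>c / 2\<close>; this is where the
      factor 2 in \<open>A * 2\<close> arises.\<close>
    proof (rule Marcinkiewicz_dyadic[where r = 1])
      fix k :: int
      define c where "c = 2 powr real_of_int k"
      define U where "U = (\<Union>i\<in>{i\<in>I. ennreal c < \<alpha> i}. K i)"
      have c: "0 < c" "2 powr real_of_int (k - 1) = c / 2" by (auto simp: c_def powr_diff)
      have U_sets: "U \<in> sets lebesgue"
        unfolding U_def using assms(2) by (intro sets.finite_UN) auto
      have "{y. ennreal c < F y} \<subseteq> U"
      proof
        fix y assume "y \<in> {y. ennreal c < F y}"
        then have y: "ennreal c < F y" by simp
        then have "F y \<noteq> 0" by auto
        then obtain i where "i \<in> I" "\<alpha> i * indicator (K i) y \<noteq> 0"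
          unfolding F_def by (rule sum.not_neutral_contains_not_neutral)
        then have "i \<in> I" "y \<in> K i" by (auto simp: indicator_def split: if_splits)
        then show "y \<in> U" using F_in y by (auto simp: U_def)
      qed
      moreover have "emeasure lebesgue U \<le> A * 2 * ennreal (2 powr (- real_of_int k * 1)) *
          (\<integral>\<^sup>+y. ennreal (h y powr 1) * indicator {y. 2 powr real_of_int (k - 1) < h y} y \<partial>lebesgue)"
      proof -
        have "emeasure lebesgue U \<le> emeasure lebesgue (\<Union>i\<in>{i\<in>I. ennreal c < \<alpha> i}. parabolic_ball p (z i) (\<rho> i))"
        proof (rule emeasure_mono)
          show "U \<subseteq> (\<Union>i\<in>{i\<in>I. ennreal c < \<alpha> i}. parabolic_ball p (z i) (\<rho> i))"
            unfolding U_def using sub(2) by blast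
        qed (use assms(2) in \<open>auto intro!: sets.finite_UN\<close>)
        also have "\<dots> \<le> A * ennreal (1 / (c / 2)) * (\<integral>\<^sup>+y. ennreal (h y) * indicator {y. c / 2 < h y} y \<partial>lebesgue)"
        proof (rule weak_type_parabolic_balls[where D = D])
          fix i assume "i \<in> {i\<in>I. ennreal c < \<alpha> i}"
          then have i: "i \<in> I" "ennreal c < \<alpha> i" by auto
          have "ennreal (c / 2) \<le> average (D i) (\<lambda>y. ennreal (h y) * indicator {y. c / 2 < h y} y)"
            using i c D_fin D by (intro average_truncation) (auto simp: \<alpha>_def)
          then have "ennreal (c / 2) * emeasure lebesgue (D i)
              \<le> average (D i) (\<lambda>y. ennreal (h y) * indicator {y. c / 2 < h y} y) * emeasure lebesgue (D i)"
            by (rule mult_right_mono) simp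
          also have "\<dots> = (\<integral>\<^sup>+y\<in>D i. (ennreal (h y) * indicator {y. c / 2 < h y} y) \<partial>lebesgue)"
            using i D_fin by (intro average_mult_emeasure) auto
          finally show "ennreal (c / 2) * emeasure lebesgue (D i)
              \<le> (\<integral>\<^sup>+y\<in>D i. (ennreal (h y) * indicator {y. c / 2 < h y} y) \<partial>lebesgue)" .
        qed (use assms c in auto)
        also have "ennreal (1 / (c / 2)) = 2 * ennreal (2 powr (- real_of_int k * 1))"
        proof -
          have "1 / (c / 2) = 2 * 2 powr (- real_of_int k * 1)"
            by (simp add: c_def powr_minus_divide)
          then show ?thesis by (simp only: ennreal_mult' zero_le_numeral ennreal_numeral)
        qed
        finally show ?thesis using h unfolding c(2) by (simp add: mult.assoc)
      qed
      ultimately show "\<exists>U\<in>sets lebesgue. {y \<in> space lebesgue. ennreal (2 powr real_of_int k) < F y} \<subseteq> U \<and>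
          emeasure lebesgue U \<le> A * 2 * ennreal (2 powr (- real_of_int k * 1)) *
            (\<integral>\<^sup>+y. ennreal (h y powr 1) * indicator {y. 2 powr real_of_int (k - 1) < h y} y \<partial>lebesgue)"
        using U_sets unfolding c_def by (intro bexI[of _ U]) auto
    qed (use assms in auto)
    then obtain G where "\<And>y. ennreal_powr (F y) b \<le> G y" and
      "(\<integral>\<^sup>+y. G y \<partial>lebesgue) \<le> ennreal (2 powr (2 * b) / (1 - 2 powr (1 - b))) * (A * 2) * (\<integral>\<^sup>+y. ennreal (h y powr b) \<partial>lebesgue)"
      by auto
    then show ?thesis by (meson nn_integral_mono order_trans)
  qed
  finally show ?thesis by (simp add: \<alpha>_def)
qed

section \<open>The level sets of the maximal function\<close>

text \<open>Keep the sets maximal under inclusion: nesting makes distinct ones disjoint, and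
  finiteness puts every set below a maximal one.\<close>

lemma maximal_sets_disjoint_cover:
  assumes "finite F" and nested: "\<And>A B. A \<in> F \<Longrightarrow> B \<in> F \<Longrightarrow> A \<inter> B = {} \<or> A \<subseteq> B \<or> B \<subseteq> A"
  shows "\<exists>G\<subseteq>F. disjoint G \<and> \<Union>G = \<Union>F"
proof -
  define G where "G = {A\<in>F. \<forall>B\<in>F. A \<subseteq> B \<longrightarrow> A = B}"
  have "disjoint G"
  proof (rule disjointI)
    fix A B assume "A \<in> G" "B \<in> G" "A \<noteq> B"
    then show "A \<inter> B = {}" using nested[of A B] unfolding G_def by auto
  qed
  moreover have "\<exists>B\<in>G. A \<subseteq> B" if "A \<in> F" for A
    using finite_has_maximal2[OF assms(1) that] unfolding G_def by blast
  then have "\<Union>F \<subseteq> \<Union>G" by blast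
  moreover have "G \<subseteq> F" unfolding G_def by blast
  ultimately show ?thesis by (intro exI[of _ G]) (meson Union_mono subset_antisym)
qed

text \<open>Continuity from below along an enumeration. It reduces the level set to finite families
  of cells, where maximal cells exist and the finite covering lemma suffices.\<close>

lemma emeasure_Union_le_of_finite:
  assumes "countable \<K>" "\<And>K. K \<in> \<K> \<Longrightarrow> K \<in> sets M"
    and "\<And>F. finite F \<Longrightarrow> F \<subseteq> \<K> \<Longrightarrow> emeasure M (\<Union>F) \<le> B"
  shows "emeasure M (\<Union>\<K>) \<le> B"
proof (cases "\<K> = {}")
  case False
  define A where "A n = \<Union>(from_nat_into \<K> ` {..n})" for n :: nat
  have in_K: "from_nat_into \<K> i \<in> \<K>" for i using False by (rule from_nat_into)
  have "range A \<subseteq> sets M"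
  proof (rule image_subsetI)
    show "A n \<in> sets M" for n
      unfolding A_def using assms(2) in_K by (intro sets.finite_Union) auto
  qed
  moreover have "incseq A"
  proof (rule incseq_SucI)
    show "A n \<le> A (Suc n)" for n
      unfolding A_def by (intro Union_mono image_mono) simp
  qed
  ultimately have "(SUP n. emeasure M (A n)) = emeasure M (\<Union>n. A n)"
    by (rule SUP_emeasure_incseq)
  moreover have "(\<Union>n. A n) = \<Union>(range (from_nat_into \<K>))"
    unfolding A_def by (metis UN_UN_flatten UN_atMost_UNIV image_UN)
  then have "(\<Union>n. A n) = \<Union>\<K>" by (simp add: range_from_nat_into[OF False assms(1)])
  moreover have le_B: "emeasure M (A n) \<le> B" for n
    unfolding A_def using in_K by (intro assms(3)) auto
  ultimately have "emeasure M (\<Union>\<K>) = (SUP n. emeasure M (A n))" by metis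
  also have "\<dots> \<le> B" by (rule SUP_least) (rule le_B)
  finally show ?thesis .
qed (use assms(3)[of "{}"] in auto)

text \<open>\<open>f\<close> is the pointwise limit of its restrictions to growing closed balls,
  each of which is integrable.\<close>

lemma locally_integrable_measurable:
  fixes f :: "'a::euclidean_space \<Rightarrow> real"
  assumes "locally_integrable f"
  shows "f \<in> borel_measurable lebesgue"
proof (rule borel_measurable_LIMSEQ_real)
  show "(\<lambda>x. indicator (cball 0 (real n)) x *\<^sub>R f x) \<in> borel_measurable lebesgue" for n :: nat
    using assms unfolding locally_integrable_def set_integrable_def
    by (meson borel_measurable_integrable compact_cball)
  show "(\<lambda>n. indicator (cball 0 (real n)) x *\<^sub>R f x) \<longlonglongrightarrow> f x" for x
  proof (rule tendsto_eventually)
    have "eventually (\<lambda>n. norm x \<le> real n) sequentially"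
      by (meson eventually_sequentiallyI le_trans of_nat_mono real_nat_ceiling_ge order_trans)
    then show "eventually (\<lambda>n. indicator (cball 0 (real n)) x *\<^sub>R f x = f x) sequentially"
      by eventually_elim simp
  qed
qed

section \<open>The weighted weak type estimate\<close>

text \<open>The two-weight Hoelder inequality for the uniform measure on the upper part, with
  \<open>W\<close> the average of \<open>w\<close> over the lower part. Its hypothesis is one term
  of the supremum defining the bump constant.\<close>

lemma bump_bounds_averages:
  fixes f w v :: "(real ^ 'n) \<times> real \<Rightarrow> real"
  assumes [measurable]: "f \<in> borel_measurable lebesgue" "v \<in> borel_measurable lebesgue"
    and nn: "\<And>z. 0 \<le> f z" "\<And>z. 0 \<le> v z"
    and "1 < q" "1 < s" "0 < r" "1 < a" "b = r * s / (q - 1)" "1 < b" "1 / a + 1 / b = 1"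
    and "bump_constant p \<gamma> q s w v < \<infinity>" "0 < L"
  shows "ennreal_powr (average (upper_part p \<gamma> x t L) (\<lambda>z. ennreal (f z))) r *
      average (lower_part p \<gamma> x t L) (\<lambda>z. ennreal (w z)) \<le>
    ennreal_powr (average (upper_part p \<gamma> x t L) (\<lambda>z. ennreal ((f z * v z powr (1 / r)) powr a))) (r / a) *
      bump_constant p \<gamma> q s w v"
proof -
  have "average (lower_part p \<gamma> x t L) (\<lambda>z. ennreal (w z)) *
      ennreal_powr (average (upper_part p \<gamma> x t L) (\<lambda>z. ennreal_powr (ennreal (v z)) (s / (1 - q))))
         ((q - 1) / s) \<le> bump_constant p \<gamma> q s w v"
    unfolding bump_constant_def by (rule SUP_upper2[of "(x, t, L)"]) (use assms in auto)
  then have le: "average (lower_part p \<gamma> x t L) (\<lambda>z. ennreal (w z)) *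
      ennreal_powr (\<integral>\<^sup>+z. ennreal_powr (ennreal (v z)) (s / (1 - q)) \<partial>uniform_measure lebesgue (upper_part p \<gamma> x t L))
         ((q - 1) / s) \<le> bump_constant p \<gamma> q s w v"
    by (subst (asm) (2) average_eq_uniform_measure) auto
  have "f \<in> borel_measurable (uniform_measure lebesgue (upper_part p \<gamma> x t L))"
    "v \<in> borel_measurable (uniform_measure lebesgue (upper_part p \<gamma> x t L))"
    by (simp_all add: measurable_def)
       (use assms(1,2) in \<open>simp_all add: measurable_def\<close>)
  from Holder_two_weight[OF this nn assms(5-11) le assms(12)]
  show ?thesis
    by (simp add: average_eq_uniform_measure)
qed

text \<open>\<open>U\<close> is a countable union of cells, so the level set itself need not be
  shown measurable. \<open>\<kappa>\<close> compares a cell with its lower part and \<open>A\<close>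
  a tripled ball with the upper part; stated as equations, they show that \<open>D\<close> is
  independent of \<open>f\<close>, \<open>w\<close>, \<open>v\<close> and \<open>c\<close>.\<close>

lemma bump_level_set_estimate:
  fixes f w v :: "(real ^ 'n) \<times> real \<Rightarrow> real"
  assumes [measurable]: "f \<in> borel_measurable lebesgue" "w \<in> borel_measurable lebesgue" "v \<in> borel_measurable lebesgue"
    and nn: "\<And>z. 0 \<le> w z" "\<And>z. 0 \<le> v z"
    and p: "1 \<le> p" "0 \<le> \<gamma>" "\<gamma> < 1"
    and qs: "1 < q" "1 < s" and ab: "1 < a" "a < r" "b = r * s / (q - 1)" "1 < b" "1 / a + 1 / b = 1"
    and fin: "bump_constant p \<gamma> q s w v < \<infinity>" and "0 < c"
    and \<kappa>: "\<kappa> = ((1 - \<gamma>) / 8) ^ CARD('n) * ((1 - \<gamma>) / 4) powr p / 2"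
    and A: "A = 6 ^ CARD('n) * (2 * 3 powr p) / (1 - \<gamma>)"
    and D: "D = 2 powr r / \<kappa> * (2 powr (2 * (r / a)) / (1 - 2 powr (1 - r / a))) * (A * 2)"
  shows "\<exists>U\<in>sets lebesgue. {z. ennreal c < centered_forward_maximal p \<gamma> f z} \<subseteq> U \<and>
    emeasure (density lebesgue (\<lambda>z. ennreal (w z))) U \<le>
      ennreal D * bump_constant p \<gamma> q s w v * ennreal (c powr (- r)) *
      (\<integral>\<^sup>+z. ennreal (\<bar>f z\<bar> powr r) * indicator {z. c / 2 < \<bar>f z\<bar>} z
        \<partial>density lebesgue (\<lambda>z. ennreal (v z)))"
proof -
  let ?\<B> = "bump_constant p \<gamma> q s w v"
  let ?w = "density lebesgue (\<lambda>z. ennreal (w z))"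
  have pos: "0 < \<kappa>" "0 < A" "0 < D" "0 < r" "1 < r / a"
  proof -
    show "0 < \<kappa>" "0 < A" "0 < r" "1 < r / a" using p ab unfolding \<kappa> A by auto
    moreover from this have "2 powr (1 - r / a) < (1 :: real)" by (simp add: powr_less_one)
    ultimately show "0 < D" unfolding D by (auto intro!: mult_pos_pos divide_pos_pos)
  qed
  define f' where "f' z = \<bar>f z\<bar> * indicator {z. c / 2 < \<bar>f z\<bar>} z" for z
  \<comment> \<open>Hoelder's inequality produces averages of exactly this \<open>h\<close>, and
    \<open>h z powr (r / a)\<close> equals \<open>f' z powr r * v z\<close>.\<close>
  define h where "h z = (f' z * v z powr (1 / r)) powr a" for z
  have [measurable]: "f' \<in> borel_measurable lebesgue" unfolding f'_def by measurable
  have [measurable]: "h \<in> borel_measurable lebesgue" unfolding h_def by measurable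
  \<comment> \<open>\<open>d\<close> encodes a rectangle witnessing that the cell \<open>K\<close>
    belongs to the level set.\<close>
  define good where "good K d \<longleftrightarrow> (case d of (x, t, L) \<Rightarrow> 0 < L \<and> K \<subseteq> lower_part p \<gamma> x t L \<and>
      ennreal \<kappa> * emeasure lebesgue (lower_part p \<gamma> x t L) \<le> emeasure lebesgue K \<and>
      ennreal c < average (upper_part p \<gamma> x t L) (\<lambda>z. ennreal \<bar>f z\<bar>))"
    for K :: "((real ^ 'n) \<times> real) set" and d
  define \<K> where "\<K> = {K. (\<exists>k z. K = cell p k z) \<and> (\<exists>d. good K d)}"
  have "\<K> \<subseteq> {cell p k z |k (z :: (real ^ 'n) \<times> real). True}" by (auto simp: \<K>_def)
  then have countable: "countable \<K>" using countable_cells countable_subset by blast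
  have \<K>_sets: "K \<in> sets lebesgue" if "K \<in> \<K>" for K
    using that by (auto simp: \<K>_def)
  have cover: "{z. ennreal c < centered_forward_maximal p \<gamma> f z} \<subseteq> \<Union>\<K>"
  proof
    fix z assume "z \<in> {z. ennreal c < centered_forward_maximal p \<gamma> f z}"
    then obtain x t L where L: "0 < L" "lower_center p \<gamma> x t L = z"
      and c: "ennreal c < average (upper_part p \<gamma> x t L) (\<lambda>z. ennreal \<bar>f z\<bar>)"
      by (auto simp: centered_forward_maximal_def less_SUP_iff)
    obtain k where "cell p k z \<subseteq> lower_part p \<gamma> x t L"
      "ennreal \<kappa> * emeasure lebesgue (lower_part p \<gamma> x t L) \<le> emeasure lebesgue (cell p k z)"
      using lower_part_contains_cell[OF p L(1), of x t] unfolding L(2) \<kappa> by blast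
    then have "good (cell p k z) (x, t, L)" using L c by (simp add: good_def)
    then have "cell p k z \<in> \<K>" unfolding \<K>_def by blast
    then show "z \<in> \<Union>\<K>" using mem_cell_self by blast
  qed
  \<comment> \<open>The weight of \<open>K\<close> is at most that of the lower part, which is the
    average of \<open>w\<close> times a Lebesgue measure comparable to that of \<open>K\<close>. The
    bump bound then removes \<open>w\<close>, and \<open>K\<close> survives only through its
    Lebesgue measure.\<close>
  have piece: "ennreal ((c / 2) powr r) * emeasure ?w K \<le>
      ennreal (1 / \<kappa>) * ?\<B> * (ennreal_powr (average (upper_part p \<gamma> x t L) (\<lambda>z. ennreal (h z))) (r / a) * emeasure lebesgue K)"
    if "K \<in> \<K>" and good: "good K (x, t, L)" for K x t L
  proof -
    have L: "0 < L" and K: "K \<subseteq> lower_part p \<gamma> x t L"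
      "ennreal \<kappa> * emeasure lebesgue (lower_part p \<gamma> x t L) \<le> emeasure lebesgue K"
      and c: "ennreal c < average (upper_part p \<gamma> x t L) (\<lambda>z. ennreal \<bar>f z\<bar>)"
      using good by (auto simp: good_def)
    let ?W = "average (lower_part p \<gamma> x t L) (\<lambda>z. ennreal (w z))"
    let ?H = "ennreal_powr (average (upper_part p \<gamma> x t L) (\<lambda>z. ennreal (h z))) (r / a)"
    have "emeasure ?w K = (\<integral>\<^sup>+z\<in>K. ennreal (w z) \<partial>lebesgue)"
      using \<K>_sets[OF \<open>K \<in> \<K>\<close>] by (simp add: emeasure_density)
    also have "\<dots> \<le> (\<integral>\<^sup>+z\<in>lower_part p \<gamma> x t L. ennreal (w z) \<partial>lebesgue)"
      using K by (intro nn_integral_mono) (auto simp: indicator_def)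
    also have "\<dots> = ?W * emeasure lebesgue (lower_part p \<gamma> x t L)"
      by (subst average_mult_emeasure) (use L p in \<open>auto simp only: emeasure_lower_part\<close>, auto)
    also have "\<dots> \<le> ?W * (ennreal (1 / \<kappa>) * emeasure lebesgue K)"
    proof (intro mult_left_mono)
      have "emeasure lebesgue (lower_part p \<gamma> x t L) = (ennreal (1 / \<kappa>) * ennreal \<kappa>) * emeasure lebesgue (lower_part p \<gamma> x t L)"
        using pos by (subst ennreal_mult[symmetric]) auto
      also have "\<dots> = ennreal (1 / \<kappa>) * (ennreal \<kappa> * emeasure lebesgue (lower_part p \<gamma> x t L))"
        by (simp only: mult.assoc)
      also have "\<dots> \<le> ennreal (1 / \<kappa>) * emeasure lebesgue K"
        using K(2) by (rule mult_left_mono) simp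
      finally show "emeasure lebesgue (lower_part p \<gamma> x t L) \<le> ennreal (1 / \<kappa>) * emeasure lebesgue K" .
    qed simp
    finally have w_le: "emeasure ?w K \<le> ?W * (ennreal (1 / \<kappa>) * emeasure lebesgue K)" .
    have "ennreal (c / 2) \<le> average (upper_part p \<gamma> x t L) (\<lambda>z. ennreal \<bar>f z\<bar> * indicator {z. c / 2 < \<bar>f z\<bar>} z)"
      by (rule average_truncation) (use c \<open>0 < c\<close> L p in \<open>auto simp only: emeasure_upper_part\<close>, auto)
    also have "(\<lambda>z. ennreal \<bar>f z\<bar> * indicator {z. c / 2 < \<bar>f z\<bar>} z) = (\<lambda>z. ennreal (f' z))"
      by (auto simp: f'_def indicator_def)
    finally have "ennreal_powr (ennreal (c / 2)) r \<le> ennreal_powr (average (upper_part p \<gamma> x t L) (\<lambda>z. ennreal (f' z))) r"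
      using pos by (intro ennreal_powr_mono)
    then have "ennreal ((c / 2) powr r) \<le> ennreal_powr (average (upper_part p \<gamma> x t L) (\<lambda>z. ennreal (f' z))) r"
      using pos \<open>0 < c\<close> by (simp add: ennreal_powr_ennreal del: ennreal_divide_numeral)
    then have "ennreal ((c / 2) powr r) * ?W \<le> ennreal_powr (average (upper_part p \<gamma> x t L) (\<lambda>z. ennreal (f' z))) r * ?W"
      by (rule mult_right_mono) simp
    also have "\<dots> \<le> ?H * ?\<B>"
      unfolding h_def using nn pos ab qs fin L
      by (intro bump_bounds_averages[where b = b]) (auto simp: f'_def)
    finally have main: "ennreal ((c / 2) powr r) * ?W \<le> ?H * ?\<B>" .
    have "ennreal ((c / 2) powr r) * emeasure ?w K \<le> ennreal ((c / 2) powr r) * (?W * (ennreal (1 / \<kappa>) * emeasure lebesgue K))"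
      by (rule mult_left_mono[OF w_le]) simp
    also have "\<dots> = (ennreal ((c / 2) powr r) * ?W) * (ennreal (1 / \<kappa>) * emeasure lebesgue K)"
      by (simp only: mult.assoc)
    also have "\<dots> \<le> (?H * ?\<B>) * (ennreal (1 / \<kappa>) * emeasure lebesgue K)"
      by (rule mult_right_mono[OF main]) simp
    also have "\<dots> = ennreal (1 / \<kappa>) * ?\<B> * (?H * emeasure lebesgue K)"
      by (simp only: mult_ac)
    finally show ?thesis .
  qed
  let ?I = "\<integral>\<^sup>+z. ennreal (\<bar>f z\<bar> powr r) * indicator {z. c / 2 < \<bar>f z\<bar>} z \<partial>density lebesgue (\<lambda>z. ennreal (v z))"
  let ?C = "ennreal D * ?\<B> * ennreal (c powr (- r)) * ?I"
  have h_int: "(\<integral>\<^sup>+z. ennreal (h z powr (r / a)) \<partial>lebesgue) = ?I"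
  proof -
    have "ennreal (h z powr (r / a)) = ennreal (v z) * (ennreal (\<bar>f z\<bar> powr r) * indicator {z. c / 2 < \<bar>f z\<bar>} z)" for z
    proof (cases "c / 2 < \<bar>f z\<bar>")
      case True
      have "h z powr (r / a) = (\<bar>f z\<bar> * v z powr (1 / r)) powr r"
        using True ab by (simp add: h_def f'_def powr_powr)
      also have "\<dots> = v z * \<bar>f z\<bar> powr r"
        using pos nn(2)[of z] by (simp add: powr_mult powr_powr)
      finally show ?thesis using True nn by (simp add: ennreal_mult)
    next
      case False
      then show ?thesis by (simp add: h_def f'_def)
    qed
    then show ?thesis by (simp add: nn_integral_density)
  qed
  have "emeasure ?w (\<Union>\<K>) \<le> ?C"
  proof (rule emeasure_Union_le_of_finite[OF countable])
    show "K \<in> sets ?w" if "K \<in> \<K>" for K using \<K>_sets[OF that] by simp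
    fix F assume F: "finite F" "F \<subseteq> \<K>"
    \<comment> \<open>Passing to maximal cells leaves the union unchanged, so its weight is still at
      most the sum of the weights of disjoint cells.\<close>
    have "\<exists>G\<subseteq>F. disjoint G \<and> \<Union>G = \<Union>F"
    proof (rule maximal_sets_disjoint_cover[OF F(1)])
      fix K K' assume "K \<in> F" "K' \<in> F"
      then obtain k z k' z' where "K = cell p k z" "K' = cell p k' z'"
        using F(2) unfolding \<K>_def by blast
      then show "K \<inter> K' = {} \<or> K \<subseteq> K' \<or> K' \<subseteq> K"
        using cells_nested[of p k z k' z'] p(1) by simp
    qed
    then obtain G where G: "G \<subseteq> F" "disjoint G" "\<Union>G = \<Union>F" by blast
    have fin_G: "finite G" using G(1) F(1) by (rule finite_subset)
    have G_\<K>: "K \<in> \<K>" if "K \<in> G" for K using that G F by blast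
    have "\<forall>K\<in>G. \<exists>d. good K d" using G_\<K> by (auto simp: \<K>_def)
    \<comment> \<open>One witnessing rectangle is fixed for each selected cell.\<close>
    from bchoice[OF this] obtain d where d: "\<And>K. K \<in> G \<Longrightarrow> good K (d K)" by blast
    define x where "x K = fst (d K)" for K
    define t where "t K = fst (snd (d K))" for K
    define L where "L K = snd (snd (d K))" for K
    have good: "good K (x K, t K, L K)" if "K \<in> G" for K
      using d[OF that] by (simp add: x_def t_def L_def)
    have L: "0 < L K" and K_lower: "K \<subseteq> lower_part p \<gamma> (x K) (t K) (L K)" if "K \<in> G" for K
      using good[OF that] by (auto simp: good_def)
    have "ennreal ((c / 2) powr r) * emeasure ?w (\<Union>F) \<le> ennreal ((c / 2) powr r) * (\<Sum>K\<in>G. emeasure ?w K)"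
    proof (rule mult_left_mono)
      have "emeasure ?w (\<Union>K\<in>G. K) \<le> (\<Sum>K\<in>G. emeasure ?w K)"
        using fin_G G_\<K> \<K>_sets by (intro emeasure_subadditive_finite) auto
      then show "emeasure ?w (\<Union>F) \<le> (\<Sum>K\<in>G. emeasure ?w K)" using G(3) by simp
    qed simp
    also have "\<dots> = (\<Sum>K\<in>G. ennreal ((c / 2) powr r) * emeasure ?w K)"
      by (rule sum_distrib_left)
    also have "\<dots> \<le> (\<Sum>K\<in>G. ennreal (1 / \<kappa>) * ?\<B> *
        (ennreal_powr (average (upper_part p \<gamma> (x K) (t K) (L K)) (\<lambda>z. ennreal (h z))) (r / a) * emeasure lebesgue K))"
      by (intro sum_mono piece G_\<K> good)
    also have "\<dots> = ennreal (1 / \<kappa>) * ?\<B> * (\<Sum>K\<in>G.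
        ennreal_powr (average (upper_part p \<gamma> (x K) (t K) (L K)) (\<lambda>z. ennreal (h z))) (r / a) * emeasure lebesgue K)"
      by (rule sum_distrib_left[symmetric])
    also have "\<dots> \<le> ennreal (1 / \<kappa>) * ?\<B> * (ennreal (2 powr (2 * (r / a)) / (1 - 2 powr (1 - r / a))) * (ennreal A * 2) *
        (\<integral>\<^sup>+z. ennreal (h z powr (r / a)) \<partial>lebesgue))"
    \<comment> \<open>The averages live on upper parts, which may overlap, while the disjoint sets
      are the cells. The exponent is \<open>r / a > 1\<close>.\<close>
    proof (intro mult_left_mono disjoint_averages_bound[OF p(1) fin_G pos(5), where z = "\<lambda>K. (x K, t K)" and \<rho> = L])
      fix K assume "K \<in> G"
      show "K \<in> sets lebesgue" using \<open>K \<in> G\<close> G_\<K> \<K>_sets by blast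
      show "emeasure lebesgue (upper_part p \<gamma> (x K) (t K) (L K)) \<noteq> 0"
        "emeasure lebesgue (upper_part p \<gamma> (x K) (t K) (L K)) \<noteq> \<infinity>"
        unfolding emeasure_upper_part[OF L[OF \<open>K \<in> G\<close>] p(3)] using L[OF \<open>K \<in> G\<close>] p by auto
      show "0 \<le> L K" using L[OF \<open>K \<in> G\<close>] by simp
      show "upper_part p \<gamma> (x K) (t K) (L K) \<subseteq> parabolic_ball p (x K, t K) (L K)"
        by (rule parts_subset_parabolic_ball(1)[OF p L[OF \<open>K \<in> G\<close>]])
      show "K \<subseteq> parabolic_ball p (x K, t K) (L K)"
        using K_lower[OF \<open>K \<in> G\<close>] parts_subset_parabolic_ball(2)[OF p L[OF \<open>K \<in> G\<close>]] by blast
      show "emeasure lebesgue (parabolic_ball p (x K, t K) (3 * L K)) \<le> ennreal A * emeasure lebesgue (upper_part p \<gamma> (x K) (t K) (L K))"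
        unfolding A by (rule eq_refl[OF emeasure_parabolic_ball_le[OF p(3) L[OF \<open>K \<in> G\<close>]]])
    next
      show "0 \<le> h z" for z by (simp add: h_def)
      show "disjoint_family_on (\<lambda>K. K) G"
        using G(2) by (auto simp: disjoint_family_on_def disjoint_def)
    qed auto
    finally have main: "ennreal ((c / 2) powr r) * emeasure ?w (\<Union>F) \<le>
      ennreal (1 / \<kappa>) * ?\<B> * (ennreal (2 powr (2 * (r / a)) / (1 - 2 powr (1 - r / a))) * (ennreal A * 2) * ?I)"
      unfolding h_int .
    \<comment> \<open>Division by \<open>(c / 2) powr r\<close> is carried out as multiplication by
      its reciprocal \<open>2 powr r * c powr (- r)\<close>.\<close>
    have "emeasure ?w (\<Union>F) = (ennreal (2 powr r * c powr (- r)) * ennreal ((c / 2) powr r)) * emeasure ?w (\<Union>F)"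
      using \<open>0 < c\<close> by (subst ennreal_mult[symmetric]) (auto simp: powr_divide powr_minus_divide)
    also have "\<dots> = ennreal (2 powr r * c powr (- r)) * (ennreal ((c / 2) powr r) * emeasure ?w (\<Union>F))"
      by (simp only: mult.assoc)
    also have "\<dots> \<le> ennreal (2 powr r * c powr (- r)) *
      (ennreal (1 / \<kappa>) * ?\<B> * (ennreal (2 powr (2 * (r / a)) / (1 - 2 powr (1 - r / a))) * (ennreal A * 2) * ?I))"
      by (rule mult_left_mono[OF main]) simp
    also have "\<dots> = (ennreal (2 powr r) * ennreal (1 / \<kappa>) * ennreal (2 powr (2 * (r / a)) / (1 - 2 powr (1 - r / a))) * (ennreal A * ennreal 2)) *
        ?\<B> * ennreal (c powr (- r)) * ?I"
      by (simp add: ennreal_mult mult_ac)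
    also have "ennreal (2 powr r) * ennreal (1 / \<kappa>) * ennreal (2 powr (2 * (r / a)) / (1 - 2 powr (1 - r / a))) * (ennreal A * ennreal 2) = ennreal D"
    proof -
      have "2 powr (1 - r / a) < (1 :: real)" using pos by (simp add: powr_less_one)
      then show ?thesis unfolding D using pos by (simp add: ennreal_mult'[symmetric] del: ennreal_numeral)
    qed
    finally show "emeasure ?w (\<Union>F) \<le> ?C" .
  qed
  moreover have "\<Union>\<K> \<in> sets lebesgue"
    using countable \<K>_sets by (intro sets.countable_Union) auto
  ultimately show ?thesis using cover by blast
qed

section \<open>The strong type inequality\<close>

theorem theorem1p7:
  fixes p \<gamma> q s :: real
  assumes "1 \<le> p" and "0 \<le> \<gamma>" and "\<gamma> < 1" and "1 < q" and "1 < s"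
  shows "\<exists>C::real. 0 < C \<and>
    (\<forall>w v :: (real ^ 'n) \<times> real \<Rightarrow> real.
       w \<in> borel_measurable lebesgue \<longrightarrow> (\<forall>z. 0 \<le> w z) \<longrightarrow>
       v \<in> borel_measurable lebesgue \<longrightarrow> (\<forall>z. 0 \<le> v z) \<longrightarrow>
       bump_constant p \<gamma> q s w v < \<infinity> \<longrightarrow>
       (\<forall>f :: (real ^ 'n) \<times> real \<Rightarrow> real. locally_integrable f \<longrightarrow>
          (\<integral>\<^sup>+z. ennreal_powr (centered_forward_maximal p \<gamma> f z) q * ennreal (w z) \<partial>lebesgue)
            \<le> ennreal C * bump_constant p \<gamma> q s w v *
               (\<integral>\<^sup>+z. ennreal_powr (ennreal \<bar>f z\<bar>) q * ennreal (v z) \<partial>lebesgue)))"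
proof -
  \<comment> \<open>The midpoint of the interval from \<open>1 + (q - 1) / s\<close> to
    \<open>q\<close>, which is nonempty because \<open>s > 1\<close>. The lower end is what
    \<open>a < r\<close> requires, the upper end what interpolation up to \<open>q\<close>
    requires.\<close>
  define r where "r = (1 + (q - 1) / s + q) / 2"
  have "y < q - 1 \<Longrightarrow> 1 + y < (1 + y + q) / 2 \<and> (1 + y + q) / 2 < q" for y by simp
  moreover have "(q - 1) / s < q - 1" using assms by (simp add: divide_less_eq)
  ultimately have r: "1 + (q - 1) / s < r" "r < q" unfolding r_def by blast+
  \<comment> \<open>The exponent that turns \<open>v powr (- 1 / r)\<close> into
    \<open>v powr (s / (1 - q))\<close>; \<open>a\<close> is its conjugate.\<close>
  define b where "b = r * s / (q - 1)"
  define a where "a = b / (b - 1)"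
  have "0 < (q - 1) / s" using assms by simp
  then have "1 < r" using r by linarith
  \<comment> \<open>Once \<open>b > 1\<close> is known this inequality is equivalent to
    \<open>a < r\<close>, and it also yields \<open>b > 1\<close>.\<close>
  have b_gt: "r < b * (r - 1)"
  proof -
    have "b * (r - 1) = r * ((r - 1) / ((q - 1) / s))" using assms by (simp add: b_def)
    moreover have "1 < (r - 1) / ((q - 1) / s)" using r \<open>0 < (q - 1) / s\<close> by (subst less_divide_eq_1_pos) linarith+
    moreover have "r * 1 < r * ((r - 1) / ((q - 1) / s))"
      using calculation \<open>1 < r\<close> by (intro mult_strict_left_mono) auto
    ultimately show ?thesis by (simp only: mult_1_right)
  qed
  have "1 < b"
  proof (rule ccontr)
    assume "\<not> 1 < b"
    then have "b * (r - 1) \<le> 1 * (r - 1)" using \<open>1 < r\<close> by (intro mult_right_mono) auto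
    then show False using b_gt by simp
  qed
  then have ab: "1 < a" "1 / a + 1 / b = 1" "a < r"
    using b_gt by (auto simp: a_def field_simps)
  define \<kappa> where "\<kappa> = ((1 - \<gamma>) / 8) ^ CARD('n) * ((1 - \<gamma>) / 4) powr p / 2"
  define A where "A = 6 ^ CARD('n) * (2 * 3 powr p) / (1 - \<gamma>)"
  define D where "D = 2 powr r / \<kappa> * (2 powr (2 * (r / a)) / (1 - 2 powr (1 - r / a))) * (A * 2)"
  \<comment> \<open>The interpolation constant; like \<open>D\<close> it depends only on the
    dimension and the exponents and lag, so \<open>E * D\<close> serves as the constant of the
    theorem.\<close>
  define E where "E = 2 powr (2 * q) / (1 - 2 powr (r - q))"
  have "0 < \<kappa>" "0 < A" using assms unfolding \<kappa>_def A_def by auto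
  have "2 powr (1 - r / a) < (1 :: real)" using ab by (simp add: powr_less_one)
  then have "0 < D" unfolding D_def using \<open>0 < \<kappa>\<close> \<open>0 < A\<close> by (auto intro!: mult_pos_pos divide_pos_pos)
  have "2 powr (r - q) < (1 :: real)" using r by (simp add: powr_less_one)
  then have "0 < E" unfolding E_def by simp
  have "(\<integral>\<^sup>+z. ennreal_powr (centered_forward_maximal p \<gamma> f z) q * ennreal (w z) \<partial>lebesgue)
      \<le> ennreal (E * D) * bump_constant p \<gamma> q s w v *
         (\<integral>\<^sup>+z. ennreal_powr (ennreal \<bar>f z\<bar>) q * ennreal (v z) \<partial>lebesgue)"
    if [measurable]: "w \<in> borel_measurable lebesgue" "v \<in> borel_measurable lebesgue"
      and nn: "\<forall>z. 0 \<le> w z" "\<forall>z. 0 \<le> v z" and fin: "bump_constant p \<gamma> q s w v < \<infinity>"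
      and "locally_integrable f"
    for w v f :: "(real ^ 'n) \<times> real \<Rightarrow> real"
  proof -
    let ?w = "density lebesgue (\<lambda>z. ennreal (w z))" and ?v = "density lebesgue (\<lambda>z. ennreal (v z))"
    have f [measurable]: "f \<in> borel_measurable lebesgue"
      using \<open>locally_integrable f\<close> by (rule locally_integrable_measurable)
    have "\<exists>G\<in>borel_measurable ?w. (\<forall>z\<in>space ?w. ennreal_powr (centered_forward_maximal p \<gamma> f z) q \<le> G z) \<and>
      (\<integral>\<^sup>+z. G z \<partial>?w) \<le> ennreal (2 powr (2 * q) / (1 - 2 powr (r - q))) * (ennreal D * bump_constant p \<gamma> q s w v) *
        (\<integral>\<^sup>+z. ennreal (\<bar>f z\<bar> powr q) \<partial>?v)"
    \<comment> \<open>The maximal function is interpolated from \<open>|f|\<close> with respect to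
      \<open>v\<close> to the measure with density \<open>w\<close>, using the level set estimate at
      \<open>c = 2 powr k\<close>.\<close>
    proof (rule Marcinkiewicz_dyadic)
      fix k :: int
      have dyadic: "2 powr real_of_int (k - 1) = 2 powr real_of_int k / (2 :: real)"
        "2 powr (- real_of_int k * r) = (2 powr real_of_int k) powr (- r)"
        by (simp_all add: powr_diff powr_powr)
      have "0 < 2 powr real_of_int k" by simp
      from bump_level_set_estimate[OF f that(1,2) nn(1)[rule_format] nn(2)[rule_format] assms ab(1,3) b_def \<open>1 < b\<close> ab(2) fin this \<kappa>_def A_def D_def]
      show "\<exists>U\<in>sets ?w. {z \<in> space ?w. ennreal (2 powr real_of_int k) < centered_forward_maximal p \<gamma> f z} \<subseteq> U \<and>
        emeasure ?w U \<le> ennreal D * bump_constant p \<gamma> q s w v * ennreal (2 powr (- real_of_int k * r)) *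
          (\<integral>\<^sup>+z. ennreal (\<bar>f z\<bar> powr r) * indicator {z. 2 powr real_of_int (k - 1) < \<bar>f z\<bar>} z \<partial>?v)"
        unfolding dyadic sets_density by blast
    qed (use r \<open>1 < r\<close> in auto)
    then obtain G where G: "G \<in> borel_measurable lebesgue" "\<And>z. ennreal_powr (centered_forward_maximal p \<gamma> f z) q \<le> G z"
      and le: "(\<integral>\<^sup>+z. G z \<partial>?w) \<le> ennreal E * (ennreal D * bump_constant p \<gamma> q s w v) * (\<integral>\<^sup>+z. ennreal (\<bar>f z\<bar> powr q) \<partial>?v)"
      unfolding E_def by auto
    \<comment> \<open>Only monotonicity of the integral is applied to the maximal function;
      measurability is needed just for \<open>G\<close> when changing to the density.\<close>
    have "(\<integral>\<^sup>+z. ennreal_powr (centered_forward_maximal p \<gamma> f z) q * ennreal (w z) \<partial>lebesgue)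
        \<le> (\<integral>\<^sup>+z. ennreal (w z) * G z \<partial>lebesgue)"
      by (intro nn_integral_mono) (subst mult.commute, intro mult_left_mono G(2), simp)
    also have "\<dots> = (\<integral>\<^sup>+z. G z \<partial>?w)"
      using G(1) by (subst nn_integral_density) auto
    also note le
    also have "(\<integral>\<^sup>+z. ennreal (\<bar>f z\<bar> powr q) \<partial>?v) = (\<integral>\<^sup>+z. ennreal_powr (ennreal \<bar>f z\<bar>) q * ennreal (v z) \<partial>lebesgue)"
      using assms by (subst nn_integral_density) (auto simp: ennreal_powr_ennreal mult.commute)
    finally show ?thesis
      using \<open>0 < D\<close> \<open>0 < E\<close> by (simp add: ennreal_mult mult.assoc)
  qed
  then show ?thesis
    using \<open>0 < D\<close> \<open>0 < E\<close> by (intro exI[of _ "E * D"]) auto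
qed

end
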